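(* There exists a symmetric norming function $\Phi_\pi$, equivalent to the maximal symmetric norming function $\Phi_1$, such that the associated norm $\|\cdot\|_{\Phi_\pi^*}$ is a symmetric norm on $\mathcal B(\ell^2(\mathbb N))$ and the identity operator satisfies $I\notin\mathcal N_{\Phi_\pi^*}(\ell^2(\mathbb N))$, i.e. $I$ is not $\Phi_\pi^*$-norming.
   Context: A symmetric norm on $\mathcal B(\mathcal H)$ is a norm $\|\cdot\|_s$ with $\|AXB\|_s\le\|A\|\,\|X\|_s\,\|B\|$ for all $A,X,B\in\mathcal B(\mathcal H)$ and $\|X\|_s=\|X\|$ (operator norm) for every rank-one $X$. Let $c_{00}$ be the space of finitely supported real sequences. A symmetric norming (s.n.) function is a norm $\Phi:c_{00}\to[0,\infty)$ with $\Phi(1,0,0,\dots)=1$ that is invariant under permuting the entries and under replacing entries by their absolute values. It is determined by its values on the cone $c_{00}^*$ of nonincreasing nonnegative sequences in $c_{00}$. The maximal s.n. function is $\Phi_1(\xi)=\sum_j|\xi_j|$. Two s.n. functions $\Phi,\Psi$ are equivalent if $\sup_{\xi\neq0}\Phi(\xi)/\Psi(\xi)<\infty$ and $\sup_{\xi\ne0}\Psi(\xi)/\Phi(\xi)<\infty$. The adjoint $\Phi^*$ of $\Phi$ is the s.n. function given on $c_{00}^*$ by $\Phi^*(\eta)=\max\{\sum_j\eta_j\xi_j:\xi\in c_{00}^*,\ \Phi(\xi)=1\}$. Let $\mathcal H$ be a separable complex Hilbert space, $\mathcal B_1(\mathcal H)$ the trace class operators, and $s_1(K)\ge s_2(K)\ge\dots$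 the singular values of a compact operator $K$ (counted with multiplicity). If $\Phi$ is an s.n. function equivalent to $\Phi_1$, then for $K\in\mathcal B_1(\mathcal H)$ put $\|K\|_\Phi=\Phi(s_1(K),s_2(K),\dots):=\lim_n\Phi(s_1(K),\dots,s_n(K),0,0,\dots)$. The norm $\|\cdot\|_{\Phi^*}$ on $\mathcal B(\mathcal H)$ is the dual norm $$\|T\|_{\Phi^*}=\sup\{|\mathrm{Tr}(TK)|:K\in\mathcal B_1(\mathcal H),\ \|K\|_\Phi\le1\}.$$ An operator $T\in\mathcal B(\mathcal H)$ is $\Phi^*$-norming if there is $K\in\mathcal B_1(\mathcal H)$ with $\|K\|_\Phi=1$ and $|\mathrm{Tr}(TK)|=\|T\|_{\Phi^*}$; $\mathcal N_{\Phi^*}(\mathcal H)$ is the set of such operators. *)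

theory Defs
  imports "HOL-Analysis.Analysis"
begin

section \<open>The complex Hilbert space of square summable sequences\<close>

typedef ell2 = "{x :: nat \<Rightarrow> complex. summable (\<lambda>n. (cmod (x n))\<^sup>2)}"
  morphisms coord Abs_ell2
  by (rule exI[of _ "\<lambda>_. 0"]) simp

setup_lifting type_definition_ell2

lemma summable_coord: "summable (\<lambda>n. (cmod (coord x n))\<^sup>2)"
  using coord[of x] by simp

lemma ell2_summable_add:
  fixes x y :: "nat \<Rightarrow> complex"
  assumes "summable (\<lambda>n. (cmod (x n))\<^sup>2)" "summable (\<lambda>n. (cmod (y n))\<^sup>2)"
  shows "summable (\<lambda>n. (cmod (x n + y n))\<^sup>2)"
proof (rule summable_comparison_test')
  show "summable (\<lambda>n. 2 * (cmod (x n))\<^sup>2 + 2 * (cmod (y n))\<^sup>2)"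
    using assms by (intro summable_add summable_mult)
  fix n
  have "(cmod (x n + y n))\<^sup>2 \<le> (cmod (x n) + cmod (y n))\<^sup>2"
    by (intro power_mono norm_triangle_ineq) auto
  also have "\<dots> \<le> 2 * (cmod (x n))\<^sup>2 + 2 * (cmod (y n))\<^sup>2"
    using sum_squares_bound[of "cmod (x n)" "cmod (y n)"] by (simp add: power2_sum)
  finally show "norm ((cmod (x n + y n))\<^sup>2) \<le> 2 * (cmod (x n))\<^sup>2 + 2 * (cmod (y n))\<^sup>2"
    by simp
qed

lemma ell2_summable_scale:
  fixes x :: "nat \<Rightarrow> complex"
  assumes "summable (\<lambda>n. (cmod (x n))\<^sup>2)"
  shows "summable (\<lambda>n. (cmod (c * x n))\<^sup>2)"
  using summable_mult[OF assms, of "(cmod c)\<^sup>2"] by (simp add: norm_mult power_mult_distrib)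

lemma ell2_summable_prod:
  fixes x y :: "nat \<Rightarrow> complex"
  assumes "summable (\<lambda>n. (cmod (x n))\<^sup>2)" "summable (\<lambda>n. (cmod (y n))\<^sup>2)"
  shows "summable (\<lambda>n. x n * cnj (y n))"
proof (rule summable_comparison_test')
  show "summable (\<lambda>n. (cmod (x n))\<^sup>2 + (cmod (y n))\<^sup>2)"
    using assms by (rule summable_add)
  fix n
  have "2 * (cmod (x n) * cmod (y n)) \<le> (cmod (x n))\<^sup>2 + (cmod (y n))\<^sup>2"
    using sum_squares_bound[of "cmod (x n)" "cmod (y n)"] by (simp add: mult.assoc)
  moreover have "0 \<le> cmod (x n) * cmod (y n)" by simp
  ultimately show "norm (x n * cnj (y n)) \<le> (cmod (x n))\<^sup>2 + (cmod (y n))\<^sup>2"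
    by (simp only: norm_mult complex_mod_cnj)
qed

instantiation ell2 :: real_vector
begin

lift_definition zero_ell2 :: ell2 is "\<lambda>_. 0" by simp
lift_definition plus_ell2 :: "ell2 \<Rightarrow> ell2 \<Rightarrow> ell2" is "\<lambda>x y n. x n + y n"
  by (rule ell2_summable_add)
lift_definition uminus_ell2 :: "ell2 \<Rightarrow> ell2" is "\<lambda>x n. - x n" by simp
lift_definition minus_ell2 :: "ell2 \<Rightarrow> ell2 \<Rightarrow> ell2" is "\<lambda>x y n. x n - y n"
  subgoal for x y using ell2_summable_add[of x "\<lambda>n. - y n"] by simp
  done
lift_definition scaleR_ell2 :: "real \<Rightarrow> ell2 \<Rightarrow> ell2" is "\<lambda>r x n. complex_of_real r * x n"
  by (rule ell2_summable_scale)

instance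
  by standard (transfer; simp add: fun_eq_iff algebra_simps)+

end

lift_definition scaleC :: "complex \<Rightarrow> ell2 \<Rightarrow> ell2" is "\<lambda>c x n. c * x n"
  by (rule ell2_summable_scale)

definition cinner :: "ell2 \<Rightarrow> ell2 \<Rightarrow> complex" where
  "cinner x y = (\<Sum>n. coord x n * cnj (coord y n))"

lemma cinner_sums: "(\<lambda>n. coord x n * cnj (coord y n)) sums cinner x y"
  unfolding cinner_def by (intro summable_sums ell2_summable_prod summable_coord)

lemma cinner_add_left: "cinner (x + y) z = cinner x z + cinner y z"
  by (rule sums_unique2[OF cinner_sums])
     (use sums_add[OF cinner_sums[of x z] cinner_sums[of y z]]
       in \<open>simp add: plus_ell2.rep_eq algebra_simps\<close>)

lemma cinner_scaleC_left: "cinner (scaleC c x) y = c * cinner x y"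
  by (rule sums_unique2[OF cinner_sums])
     (use sums_mult[OF cinner_sums[of x y], of c] in \<open>simp add: scaleC.rep_eq algebra_simps\<close>)

lemma scaleR_scaleC: "r *\<^sub>R x = scaleC (complex_of_real r) x"
  by transfer simp

lemma cinner_commute: "cinner y x = cnj (cinner x y)"
proof -
  have "(\<lambda>n. cnj (coord x n * cnj (coord y n))) sums cnj (cinner x y)"
    using cinner_sums[of x y] by (simp only: sums_cnj)
  then show ?thesis
    using sums_unique2[OF cinner_sums[of y x]] by (simp add: mult.commute)
qed

lemma Re_cinner_self: "Re (cinner x x) = (\<Sum>n. (cmod (coord x n))\<^sup>2)"
proof (rule sums_unique)
  have "(\<lambda>n. Re (coord x n * cnj (coord x n))) sums Re (cinner x x)"
    using cinner_sums[of x x] by (rule sums_Re)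
  then show "(\<lambda>n. (cmod (coord x n))\<^sup>2) sums Re (cinner x x)"
    by (simp add: complex_norm_square[symmetric] flip: of_real_power)
qed

text \<open>The real inner product is the real part of the complex one; both induce the same norm.\<close>

instantiation ell2 :: real_inner
begin

definition inner_ell2 :: "ell2 \<Rightarrow> ell2 \<Rightarrow> real" where
  "inner_ell2 x y = Re (cinner x y)"
definition norm_ell2 :: "ell2 \<Rightarrow> real" where
  "norm_ell2 x = sqrt (\<Sum>n. (cmod (coord x n))\<^sup>2)"
definition sgn_ell2 :: "ell2 \<Rightarrow> ell2" where
  "sgn_ell2 x = x /\<^sub>R norm x"
definition dist_ell2 :: "ell2 \<Rightarrow> ell2 \<Rightarrow> real" where
  "dist_ell2 x y = norm (x - y)"
definition uniformity_ell2 :: "(ell2 \<times> ell2) filter" where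
  "uniformity_ell2 = (INF e\<in>{0<..}. principal {(x, y). dist x y < e})"
definition open_ell2 :: "ell2 set \<Rightarrow> bool" where
  "open_ell2 U = (\<forall>x\<in>U. \<forall>\<^sub>F (x', y) in uniformity. x' = x \<longrightarrow> y \<in> U)"

instance
proof
  fix x y z :: ell2 and r :: real and U :: "ell2 set"
  show "dist x y = norm (x - y)" by (rule dist_ell2_def)
  show "sgn x = x /\<^sub>R norm x" by (rule sgn_ell2_def)
  show "(uniformity :: (ell2 \<times> ell2) filter) = (INF e\<in>{0<..}. principal {(x, y). dist x y < e})"
    by (rule uniformity_ell2_def)
  show "open U = (\<forall>x\<in>U. \<forall>\<^sub>F (x', y) in uniformity. x' = x \<longrightarrow> y \<in> U)"
    by (rule open_ell2_def)
  show "inner x y = inner y x"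
    unfolding inner_ell2_def by (subst cinner_commute) simp
  show "inner (x + y) z = inner x z + inner y z"
    by (simp add: inner_ell2_def cinner_add_left)
  show "inner (r *\<^sub>R x) y = r * inner x y"
    by (simp add: inner_ell2_def scaleR_scaleC cinner_scaleC_left)
  show "0 \<le> inner x x"
    by (simp add: inner_ell2_def Re_cinner_self suminf_nonneg summable_coord)
  show "inner x x = 0 \<longleftrightarrow> x = 0"
  proof -
    have "inner x x = 0 \<longleftrightarrow> (\<forall>n. coord x n = 0)"
      unfolding inner_ell2_def Re_cinner_self
      by (subst suminf_eq_zero_iff) (simp_all add: summable_coord)
    also have "\<dots> \<longleftrightarrow> x = 0"
      by transfer (simp add: fun_eq_iff)
    finally show ?thesis .
  qed
  show "norm x = sqrt (inner x x)"
    by (simp add: norm_ell2_def inner_ell2_def Re_cinner_self)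
qed

end

lemma norm_scaleC: "norm (scaleC c x) = cmod c * norm x"
proof -
  have "(\<Sum>n. (cmod (coord (scaleC c x) n))\<^sup>2) = (cmod c)\<^sup>2 * (\<Sum>n. (cmod (coord x n))\<^sup>2)"
    using suminf_mult[OF summable_coord[of x], of "(cmod c)\<^sup>2"]
    by (simp add: scaleC.rep_eq norm_mult power_mult_distrib)
  then show ?thesis
    by (simp add: norm_ell2_def real_sqrt_mult)
qed

lemma vector_space_scaleC: "vector_space scaleC"
  by unfold_locales (transfer; simp add: fun_eq_iff algebra_simps)+

interpretation ell2: vector_space scaleC
  by (rule vector_space_scaleC)

lift_definition unit_vec :: "nat \<Rightarrow> ell2" is "\<lambda>k n. if n = k then 1 else 0"
  by (rule summable_finite[of "{k}" for k]) auto


section \<open>Bounded operators\<close>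

text \<open>
  The type \<open>ell2 \<Rightarrow>\<^sub>L ell2\<close> consists of the real linear bounded maps, normed by the operator norm;
  the algebra of bounded operators is its subset of complex linear maps.
\<close>

definition bounded_ops :: "(ell2 \<Rightarrow>\<^sub>L ell2) set" where
  "bounded_ops = {T. \<forall>c x. blinfun_apply T (scaleC c x) = scaleC c (blinfun_apply T x)}"

lemma bounded_linear_scaleC: "bounded_linear (scaleC c)"
  by (rule bounded_linear_intro[of _ "cmod c"])
     (simp_all add: scaleR_scaleC norm_scaleC mult.commute ell2.scale_right_distrib)

definition scaleC_op :: "complex \<Rightarrow> (ell2 \<Rightarrow>\<^sub>L ell2) \<Rightarrow> (ell2 \<Rightarrow>\<^sub>L ell2)" where
  "scaleC_op c T = Blinfun (scaleC c) o\<^sub>L T"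

lemma scaleC_op_apply: "blinfun_apply (scaleC_op c T) x = scaleC c (blinfun_apply T x)"
  by (simp add: scaleC_op_def bounded_linear_Blinfun_apply bounded_linear_scaleC)

definition hilbert_adjoint :: "(ell2 \<Rightarrow>\<^sub>L ell2) \<Rightarrow> (ell2 \<Rightarrow>\<^sub>L ell2)" where
  "hilbert_adjoint T =
    (THE S. S \<in> bounded_ops \<and>
      (\<forall>x y. cinner (blinfun_apply T x) y = cinner x (blinfun_apply S y)))"

definition compact_op :: "(ell2 \<Rightarrow>\<^sub>L ell2) \<Rightarrow> bool" where
  "compact_op K \<longleftrightarrow> K \<in> bounded_ops \<and> compact (closure (blinfun_apply K ` cball 0 1))"

definition rank_one :: "(ell2 \<Rightarrow>\<^sub>L ell2) \<Rightarrow> bool" where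
  "rank_one X \<longleftrightarrow> X \<in> bounded_ops \<and> ell2.dim (range (blinfun_apply X)) = 1"

definition eigenspace :: "(ell2 \<Rightarrow>\<^sub>L ell2) \<Rightarrow> real \<Rightarrow> ell2 set" where
  "eigenspace T \<mu> = {x. blinfun_apply T x = scaleC (complex_of_real \<mu>) x}"

text \<open>
  The singular values of a compact operator \<open>K\<close> are the square roots of the eigenvalues of
  \<open>K\<^sup>*K\<close>, in nonincreasing order, counted with multiplicity (indices start at \<open>0\<close>), padded with
  zeros if \<open>K\<close> has finite rank. For compact \<open>K\<close> the eigenspaces below are finite-dimensional and
  the conditions determine the sequence uniquely. The value \<open>0\<close> carries no condition, because a
  sequence with infinitely many positive terms does not list the kernel of \<open>K\<close>.
\<close>

definition singular_values :: "(ell2 \<Rightarrow>\<^sub>L ell2) \<Rightarrow> nat \<Rightarrow> real" where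
  "singular_values K =
    (THE s. decseq s \<and> (\<forall>n. 0 \<le> s n) \<and>
      (\<forall>\<mu>>0. finite {n. s n = \<mu>} \<and>
        card {n. s n = \<mu>} = ell2.dim (eigenspace (hilbert_adjoint K o\<^sub>L K) (\<mu>\<^sup>2))))"

definition trace_class :: "(ell2 \<Rightarrow>\<^sub>L ell2) set" where
  "trace_class = {K. compact_op K \<and> summable (singular_values K)}"

text \<open>For trace class operators the trace does not depend on the orthonormal basis.\<close>

definition op_trace :: "(ell2 \<Rightarrow>\<^sub>L ell2) \<Rightarrow> complex" where
  "op_trace K = (\<Sum>n. cinner (blinfun_apply K (unit_vec n)) (unit_vec n))"

definition symmetric_norm :: "((ell2 \<Rightarrow>\<^sub>L ell2) \<Rightarrow> real) \<Rightarrow> bool" where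
  "symmetric_norm N \<longleftrightarrow>
    (\<forall>X\<in>bounded_ops. 0 \<le> N X \<and> (N X = 0 \<longleftrightarrow> X = 0)) \<and>
    (\<forall>X\<in>bounded_ops. \<forall>c. N (scaleC_op c X) = cmod c * N X) \<and>
    (\<forall>X\<in>bounded_ops. \<forall>Y\<in>bounded_ops. N (X + Y) \<le> N X + N Y) \<and>
    (\<forall>A\<in>bounded_ops. \<forall>X\<in>bounded_ops. \<forall>B\<in>bounded_ops.
      N (A o\<^sub>L X o\<^sub>L B) \<le> norm A * N X * norm B) \<and>
    (\<forall>X. rank_one X \<longrightarrow> N X = norm X)"


section \<open>Symmetric norming functions\<close>

text \<open>A symmetric norming function is only meaningful on finitely supported sequences.\<close>

definition c00 :: "(nat \<Rightarrow> real) set" where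
  "c00 = {\<xi>. finite {n. \<xi> n \<noteq> 0}}"

definition sn_function :: "((nat \<Rightarrow> real) \<Rightarrow> real) \<Rightarrow> bool" where
  "sn_function \<Phi> \<longleftrightarrow>
    (\<forall>\<xi>\<in>c00. 0 \<le> \<Phi> \<xi> \<and> (\<Phi> \<xi> = 0 \<longleftrightarrow> \<xi> = (\<lambda>_. 0))) \<and>
    (\<forall>\<xi>\<in>c00. \<forall>a. \<Phi> (\<lambda>n. a * \<xi> n) = \<bar>a\<bar> * \<Phi> \<xi>) \<and>
    (\<forall>\<xi>\<in>c00. \<forall>\<eta>\<in>c00. \<Phi> (\<lambda>n. \<xi> n + \<eta> n) \<le> \<Phi> \<xi> + \<Phi> \<eta>) \<and>
    \<Phi> (\<lambda>n. if n = 0 then 1 else 0) = 1 \<and>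
    (\<forall>\<xi>\<in>c00. \<forall>p. bij p \<longrightarrow> \<Phi> (\<xi> \<circ> p) = \<Phi> \<xi>) \<and>
    (\<forall>\<xi>\<in>c00. \<Phi> (\<lambda>n. \<bar>\<xi> n\<bar>) = \<Phi> \<xi>)"

definition max_sn_function :: "(nat \<Rightarrow> real) \<Rightarrow> real" where
  "max_sn_function \<xi> = (\<Sum>j | \<xi> j \<noteq> 0. \<bar>\<xi> j\<bar>)"

definition sn_equivalent :: "((nat \<Rightarrow> real) \<Rightarrow> real) \<Rightarrow> ((nat \<Rightarrow> real) \<Rightarrow> real) \<Rightarrow> bool" where
  "sn_equivalent \<Phi> \<Psi> \<longleftrightarrow>
    bdd_above ((\<lambda>\<xi>. \<Phi> \<xi> / \<Psi> \<xi>) ` (c00 - {\<lambda>_. 0})) \<and>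
    bdd_above ((\<lambda>\<xi>. \<Psi> \<xi> / \<Phi> \<xi>) ` (c00 - {\<lambda>_. 0}))"

definition ideal_norm :: "((nat \<Rightarrow> real) \<Rightarrow> real) \<Rightarrow> (ell2 \<Rightarrow>\<^sub>L ell2) \<Rightarrow> real" where
  "ideal_norm \<Phi> K = lim (\<lambda>n. \<Phi> (\<lambda>j. if j < n then singular_values K j else 0))"

text \<open>
  The supremum is that of a bounded set, and the limit above exists for trace class operators, when
  \<open>\<Phi>\<close> is a symmetric norming function equivalent to the maximal one; only this case matters.
\<close>

definition dual_norm :: "((nat \<Rightarrow> real) \<Rightarrow> real) \<Rightarrow> (ell2 \<Rightarrow>\<^sub>L ell2) \<Rightarrow> real" where
  "dual_norm \<Phi> T = Sup {cmod (op_trace (T o\<^sub>L K)) | K. K \<in> trace_class \<and> ideal_norm \<Phi> K \<le> 1}"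

definition norming_ops :: "((nat \<Rightarrow> real) \<Rightarrow> real) \<Rightarrow> (ell2 \<Rightarrow>\<^sub>L ell2) set" where
  "norming_ops \<Phi> =
    {T \<in> bounded_ops. \<exists>K\<in>trace_class. ideal_norm \<Phi> K = 1 \<and>
      cmod (op_trace (T o\<^sub>L K)) = dual_norm \<Phi> T}"

end

theory Submission
  imports Defs
begin

text \<open>
  Take \<open>\<Phi> \<xi> = (\<Sum>\<bar>\<xi> j\<bar> + sup \<bar>\<xi> j\<bar>) / 2\<close>, which lies between half of the maximal norming function and the
  maximal one. On the trace class it induces \<open>(\<parallel>K\<parallel>\<^sub>1 + \<parallel>K\<parallel>) / 2\<close>. Testing the identity against multiples
  of the coordinate projection of rank \<open>n\<close> gives \<open>2n / (n + 1)\<close>, so its dual norm is at least \<open>2\<close>. But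
  \<open>\<bar>Tr K\<bar> \<le> \<parallel>K\<parallel>\<^sub>1 = 2 - \<parallel>K\<parallel> < 2\<close> whenever \<open>K\<close> has norm one, so no \<open>K\<close> attains it.

  The dual norm is symmetric because sums of singular values are controlled without a choice of
  eigenvectors: if \<open>L = \<Sum>\<^sub>k \<langle>\<cdot>, a\<^sub>k\<rangle> b\<^sub>k\<close>, then the trace of \<open>L\<close> is \<open>\<Sum>\<^sub>k \<langle>b\<^sub>k, a\<^sub>k\<rangle>\<close>, and the Bessel and
  Cauchy--Schwarz inequalities bound its singular values by \<open>\<Sum>\<^sub>k s\<^sub>k(L) \<le> \<Sum>\<^sub>k \<parallel>a\<^sub>k\<parallel> \<parallel>b\<^sub>k\<parallel>\<close>.
\<close>

section \<open>The complex inner product\<close>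

lemma cinner_scaleC_right: "cinner x (scaleC c y) = cnj c * cinner x y"
  by (metis cinner_commute cinner_scaleC_left complex_cnj_mult)

lemma cinner_add_right: "cinner x (y + z) = cinner x y + cinner x z"
  by (metis cinner_commute cinner_add_left complex_cnj_add)

lemma inner_eq_Re_cinner: "x \<bullet> y = Re (cinner x y)"
  by (simp add: inner_ell2_def)

lemma cinner_self: "cinner x x = complex_of_real ((norm x)\<^sup>2)"
proof -
  have "Im (cinner x x) = 0"
    using arg_cong[OF cinner_commute[of x x], of Im] by simp
  moreover have "Re (cinner x x) = (norm x)\<^sup>2"
    by (simp add: power2_norm_eq_inner inner_eq_Re_cinner)
  ultimately show ?thesis by (simp add: complex_eq_iff)
qed

text \<open>The real Cauchy-Schwarz inequality bounds only the real part of \<open>cinner\<close>.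
  Multiplying \<open>x\<close> by a unimodular scalar makes the inner product real and nonnegative
  without changing norms.\<close>

lemma cinner_norm_le: "cmod (cinner x y) \<le> norm x * norm y"
proof (cases "cinner x y = 0")
  case False
  define c where "c = cnj (sgn (cinner x y))"
  have c: "cmod c = 1" using False by (simp add: c_def norm_sgn)
  have "c * cinner x y = complex_of_real (cmod (cinner x y))"
    using False by (simp add: c_def sgn_div_norm scaleR_conv_of_real field_simps complex_norm_square[symmetric] power2_eq_square)
  then have "cmod (cinner x y) = scaleC c x \<bullet> y"
    by (simp add: inner_eq_Re_cinner cinner_scaleC_left)
  also have "\<dots> \<le> norm (scaleC c x) * norm y"
    by (rule norm_cauchy_schwarz)
  finally show ?thesis by (simp add: norm_scaleC c)
qed simp

text \<open>\<open>cinner\<close> is conjugate linear in its second argument, hence bilinear only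
  over the reals. This suffices for moving limits, sums and differences through it.\<close>

interpretation cinner: bounded_bilinear cinner
proof
  show "\<exists>K. \<forall>a b. norm (cinner a b) \<le> norm a * norm b * K"
    using cinner_norm_le by (intro exI[of _ 1]) simp
qed (simp_all add: cinner_add_left cinner_add_right scaleR_scaleC cinner_scaleC_left
       cinner_scaleC_right scaleR_conv_of_real)

interpretation scaleC: bounded_bilinear scaleC
proof
  show "\<exists>K. \<forall>a b. norm (scaleC a b) \<le> norm a * norm b * K"
    by (intro exI[of _ 1]) (simp add: norm_scaleC)
qed (simp_all add: scaleR_scaleC ell2.scale_right_distrib ell2.scale_left_distrib
       scaleR_conv_of_real mult.commute)

lemma cinner_eqI:
  assumes "\<And>x. cinner x y = cinner x z"
  shows "y = z"
proof -
  have "cinner (y - z) (y - z) = 0" by (simp add: cinner.diff_right assms)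
  then show ?thesis by (simp add: cinner_self)
qed

lemma cinner_unit_vec: "cinner x (unit_vec n) = coord x n"
proof -
  have "(\<lambda>k. coord x k * cnj (coord (unit_vec n) k)) = (\<lambda>k. if k = n then coord x k else 0)"
    by (auto simp: unit_vec.rep_eq fun_eq_iff)
  then show ?thesis
    using sums_single[of n "coord x"] cinner_sums[of x "unit_vec n"] by (intro sums_unique2) simp_all
qed

lemma norm_unit_vec: "norm (unit_vec n) = 1"
proof -
  have "(norm (unit_vec n))\<^sup>2 = 1"
    using cinner_unit_vec[of "unit_vec n" n] by (simp add: cinner_self unit_vec.rep_eq flip: of_real_power)
  then show ?thesis using power2_eq_iff_nonneg[of "norm (unit_vec n)" 1] by simp
qed

lemma norm_sums_coord: "(\<lambda>n. (cmod (coord x n))\<^sup>2) sums (norm x)\<^sup>2"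
  using summable_sums[OF summable_coord[of x]]
  by (simp add: norm_ell2_def suminf_nonneg summable_coord)

lemma coord_sum: "coord (sum f A) n = (\<Sum>k\<in>A. coord (f k) n)"
  by (induction A rule: infinite_finite_induct) (auto simp: zero_ell2.rep_eq plus_ell2.rep_eq)

text \<open>A partial sum is a truncation of \<open>x\<close>, so the squared error is a tail of the
  convergent series for the squared norm.\<close>

lemma unit_vec_sums: "(\<lambda>n. scaleC (coord x n) (unit_vec n)) sums x"
proof -
  have *: "(norm ((\<Sum>k<n. scaleC (coord x k) (unit_vec k)) - x))\<^sup>2 = (norm x)\<^sup>2 - (\<Sum>k<n. (cmod (coord x k))\<^sup>2)" (is "?L = ?R") for n
  proof -
    have c: "coord ((\<Sum>k<n. scaleC (coord x k) (unit_vec k)) - x) j = (if j < n then 0 else - coord x j)" for j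
      by (simp add: minus_ell2.rep_eq coord_sum scaleC.rep_eq unit_vec.rep_eq if_distrib cong: if_cong)
    have "(\<lambda>j. (if j < n then 0 else (cmod (coord x j))\<^sup>2)) sums ?L"
      using norm_sums_coord[of "(\<Sum>k<n. scaleC (coord x k) (unit_vec k)) - x"]
      by (simp add: c if_distrib[of "\<lambda>z. (cmod z)\<^sup>2"] cong: if_cong)
    moreover have "(\<lambda>j. (if j < n then 0 else (cmod (coord x j))\<^sup>2)) sums ?R"
      using sums_diff[OF norm_sums_coord[of x] sums_If_finite_set[of "{..<n}" "\<lambda>j. (cmod (coord x j))\<^sup>2"]]
      by (rule sums_cong[THEN iffD1, rotated]) simp_all
    ultimately show ?thesis by (rule sums_unique2)
  qed
  have "(\<lambda>n. (norm x)\<^sup>2 - (\<Sum>k<n. (cmod (coord x k))\<^sup>2)) \<longlonglongrightarrow> (norm x)\<^sup>2 - (norm x)\<^sup>2"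
    using norm_sums_coord[of x] unfolding sums_def by (intro tendsto_diff tendsto_const)
  then have "(\<lambda>n. (norm ((\<Sum>k<n. scaleC (coord x k) (unit_vec k)) - x))\<^sup>2) \<longlonglongrightarrow> 0"
    unfolding * by simp
  from tendsto_real_sqrt[OF this] show ?thesis
    unfolding sums_def by (subst LIM_zero_iff[symmetric]) (simp add: tendsto_norm_zero_iff)
qed

section \<open>Bounded operators\<close>

lemma bounded_opsD: "T \<in> bounded_ops \<Longrightarrow> blinfun_apply T (scaleC c x) = scaleC c (blinfun_apply T x)"
  by (simp add: bounded_ops_def)

lemma Blinfun_in_bounded_ops:
  assumes "\<And>x y. f (x + y) = f x + f y" "\<And>c x. f (scaleC c x) = scaleC c (f x)"
    and "\<And>x. norm (f x) \<le> B * norm x"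
  shows "Blinfun f \<in> bounded_ops" "blinfun_apply (Blinfun f) = f"
proof -
  have "bounded_linear f"
    by (rule bounded_linear_intro[of _ B]) (use assms in \<open>simp_all add: scaleR_scaleC mult.commute\<close>)
  then show "blinfun_apply (Blinfun f) = f" by (rule bounded_linear_Blinfun_apply)
  then show "Blinfun f \<in> bounded_ops" by (simp add: bounded_ops_def assms)
qed

lemma bounded_ops_compose: "S \<in> bounded_ops \<Longrightarrow> T \<in> bounded_ops \<Longrightarrow> S o\<^sub>L T \<in> bounded_ops"
  by (simp add: bounded_ops_def)

lemma bounded_ops_add: "S \<in> bounded_ops \<Longrightarrow> T \<in> bounded_ops \<Longrightarrow> S + T \<in> bounded_ops"
  by (simp add: bounded_ops_def blinfun.add_left ell2.scale_right_distrib)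

lemma bounded_ops_id: "id_blinfun \<in> bounded_ops"
  by (simp add: bounded_ops_def)

text \<open>The only candidate sends \<open>y\<close> to the sequence \<open>v y\<close>. Its square
  summability comes from applying \<open>T\<close> to the truncation \<open>z\<close> of that same
  sequence: the pairing of \<open>y\<close> with \<open>T z\<close> equals the squared norm of
  \<open>z\<close>, so one factor \<open>norm z\<close> cancels and leaves a bound uniform in the
  truncation.\<close>

lemma adjoint_exists:
  assumes "T \<in> bounded_ops"
  shows "\<exists>S\<in>bounded_ops. \<forall>x y. cinner (blinfun_apply T x) y = cinner x (blinfun_apply S y)"
proof -
  define v where "v y n = cinner y (blinfun_apply T (unit_vec n))" for y n
  have le: "(\<Sum>k<n. (cmod (v y k))\<^sup>2) \<le> (norm T * norm y)\<^sup>2" for y n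
  proof -
    define z where "z = (\<Sum>k<n. scaleC (v y k) (unit_vec k))"
    let ?s = "\<Sum>k<n. (cmod (v y k))\<^sup>2"
    have cz: "coord z j = (if j < n then v y j else 0)" for j
      by (simp add: z_def coord_sum scaleC.rep_eq unit_vec.rep_eq if_distrib cong: if_cong)
    have "(\<lambda>j. (cmod (coord z j))\<^sup>2) sums ?s"
      using sums_If_finite_set[of "{..<n}" "\<lambda>j. (cmod (v y j))\<^sup>2"] by (simp add: cz if_distrib[of "\<lambda>z. (cmod z)\<^sup>2"] cong: if_cong)
    then have nz: "(norm z)\<^sup>2 = ?s" using norm_sums_coord sums_unique2 by blast
    have "cinner y (blinfun_apply T z) = (\<Sum>k<n. cnj (v y k) * v y k)"
      by (simp add: z_def blinfun.sum_right cinner.sum_right bounded_opsD[OF assms] cinner_scaleC_right v_def)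
    also have "\<dots> = complex_of_real ?s"
      by (simp add: mult.commute complex_norm_square[symmetric] del: of_real_power) 
    finally have "cmod (cinner y (blinfun_apply T z)) = ?s"
      by (simp only: norm_of_real) (simp add: sum_nonneg)
    then have "?s \<le> norm y * norm (blinfun_apply T z)"
      using cinner_norm_le[of y "blinfun_apply T z"] by simp
    also have "\<dots> \<le> norm y * (norm T * norm z)"
      by (intro mult_left_mono norm_blinfun) auto
    finally have *: "norm z * norm z \<le> (norm T * norm y) * norm z"
      unfolding nz[symmetric] unfolding power2_eq_square by (simp add: mult_ac)
    have "norm z \<le> norm T * norm y"
    proof (cases "norm z = 0")
      case False
      then have "0 < norm z" by simp
      then show ?thesis using * by (simp only: mult_le_cancel_right_pos)
    qed simp
    then show ?thesis unfolding nz[symmetric] by (intro power_mono) auto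
  qed
  have sm: "summable (\<lambda>k. (cmod (v y k))\<^sup>2)" for y
    by (rule summableI_nonneg_bounded[OF _ le]) simp
  define S where "S y = Abs_ell2 (v y)" for y
  have cS: "coord (S y) n = v y n" for y n
    unfolding S_def using sm[of y] by (subst Abs_ell2_inverse) auto
  have nS: "norm (S y) \<le> norm T * norm y" for y
  proof -
    have "(norm (S y))\<^sup>2 \<le> (norm T * norm y)\<^sup>2"
      using norm_sums_coord[of "S y"] le[of y] unfolding sums_def cS
      by (intro LIMSEQ_le_const2) auto
    then show ?thesis by (rule power2_le_imp_le) simp
  qed
  have coord_inject': "(\<And>n. coord x n = coord y n) \<Longrightarrow> x = y" for x y
    using coord_inject[of x y] by (simp add: fun_eq_iff)
  have lin: "S (x + y) = S x + S y" "S (scaleC c x) = scaleC c (S x)" for x y c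
    by (rule coord_inject', simp add: cS v_def plus_ell2.rep_eq scaleC.rep_eq cinner_add_left cinner_scaleC_left)+
  note S = Blinfun_in_bounded_ops[of S, OF lin nS]
  have "cinner (blinfun_apply T x) y = cinner x (S y)" for x y
  proof -
    have "(\<lambda>n. cinner (blinfun_apply T (scaleC (coord x n) (unit_vec n))) y) sums cinner (blinfun_apply T x) y"
      by (rule bounded_linear.sums[OF cinner.bounded_linear_left, OF bounded_linear.sums[OF blinfun.bounded_linear_right unit_vec_sums]])
    moreover have "cinner (blinfun_apply T (scaleC (coord x n) (unit_vec n))) y = coord x n * cnj (coord (S y) n)" for n
      by (simp add: bounded_opsD[OF assms] cinner_scaleC_left cS v_def cinner_commute[of y])
    ultimately show ?thesis using sums_unique2[OF _ cinner_sums[of x "S y"]] by simp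
  qed
  then show ?thesis using S by (intro bexI[of _ "Blinfun S"]) simp_all
qed

lemma hilbert_adjoint:
  assumes "T \<in> bounded_ops"
  shows "hilbert_adjoint T \<in> bounded_ops"
    and "cinner (blinfun_apply T x) y = cinner x (blinfun_apply (hilbert_adjoint T) y)"
proof -
  have "\<exists>!S. S \<in> bounded_ops \<and> (\<forall>x y. cinner (blinfun_apply T x) y = cinner x (blinfun_apply S y))"
    using adjoint_exists[OF assms] by (auto intro!: blinfun_eqI cinner_eqI)
  from theI'[OF this] show "hilbert_adjoint T \<in> bounded_ops"
    and "cinner (blinfun_apply T x) y = cinner x (blinfun_apply (hilbert_adjoint T) y)"
    unfolding hilbert_adjoint_def by blast+
qed

lemma norm_hilbert_adjoint_apply:
  assumes "T \<in> bounded_ops"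
  shows "norm (blinfun_apply (hilbert_adjoint T) y) \<le> norm T * norm y"
proof -
  let ?z = "blinfun_apply (hilbert_adjoint T) y"
  have "norm ?z * norm ?z = cmod (cinner (blinfun_apply T ?z) y)"
    by (simp add: hilbert_adjoint(2)[OF assms] cinner_self norm_mult power2_eq_square)
  also have "\<dots> \<le> norm (blinfun_apply T ?z) * norm y" by (rule cinner_norm_le)
  also have "\<dots> \<le> norm T * norm ?z * norm y" by (intro mult_right_mono norm_blinfun) auto
  finally show ?thesis
    by (cases "norm ?z = 0") (auto simp: mult_ac)
qed

section \<open>Compact operators\<close>

text \<open>In Dirac notation this is |b><a|. The vector \<open>a\<close> occupies the conjugate
  linear slot, so the map is complex linear in \<open>x\<close>; it has rank one unless
  \<open>a\<close> or \<open>b\<close> vanishes.\<close>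

definition ket_bra :: "ell2 \<Rightarrow> ell2 \<Rightarrow> (ell2 \<Rightarrow>\<^sub>L ell2)" where
  "ket_bra b a = Blinfun (\<lambda>x. scaleC (cinner x a) b)"

lemma ket_bra: "ket_bra b a \<in> bounded_ops" "blinfun_apply (ket_bra b a) x = scaleC (cinner x a) b"
proof -
  have "norm (scaleC (cinner x a) b) \<le> (norm a * norm b) * norm x" for x
    using mult_right_mono[OF cinner_norm_le[of x a], of "norm b"] by (simp add: norm_scaleC mult_ac)
  note * = Blinfun_in_bounded_ops[OF _ _ this, folded ket_bra_def]
  show "ket_bra b a \<in> bounded_ops" "blinfun_apply (ket_bra b a) x = scaleC (cinner x a) b"
    by (subst *; simp add: cinner_add_left cinner_scaleC_left ell2.scale_left_distrib)+
qed

lemma compact_opI: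
  assumes "K \<in> bounded_ops" "compact C" "\<And>x. norm x \<le> 1 \<Longrightarrow> blinfun_apply K x \<in> C"
  shows "compact_op K"
proof -
  have "closure (blinfun_apply K ` cball 0 1) \<subseteq> C"
    by (intro closure_minimal compact_imp_closed assms(2)) (use assms(3) in auto)
  then show ?thesis
    unfolding compact_op_def
    using assms(1) compact_Int_closed[OF assms(2) closed_closure[of "blinfun_apply K ` cball 0 1"]]
    by (simp add: inf.absorb2)
qed

lemma compact_opD:
  assumes "compact_op K" "norm x \<le> 1"
  shows "blinfun_apply K x \<in> closure (blinfun_apply K ` cball 0 1)"
  by (rule subsetD[OF closure_subset], rule imageI) (use assms(2) in simp)

lemma compact_op_ket_bra: "compact_op (ket_bra b a)"
proof (rule compact_opI)
  show "compact ((\<lambda>c. scaleC c b) ` cball 0 (norm a))"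
    by (intro compact_continuous_image continuous_intros linear_continuous_on scaleC.bounded_linear_left compact_cball)
  fix x :: ell2 assume "norm x \<le> 1"
  then have "cmod (cinner x a) \<le> norm a"
    using cinner_norm_le[of x a] mult_right_mono[of "norm x" 1 "norm a"] by simp
  then show "blinfun_apply (ket_bra b a) x \<in> (\<lambda>c. scaleC c b) ` cball 0 (norm a)"
    by (auto simp: ket_bra)
qed (rule ket_bra)

lemma compact_op_zero: "compact_op 0"
  by (rule compact_opI[of _ "{0}"]) (simp_all add: bounded_ops_def)

lemma compact_op_add:
  assumes "compact_op K" "compact_op L"
  shows "compact_op (K + L)"
proof (rule compact_opI)
  let ?C = "\<lambda>K. closure (blinfun_apply K ` cball 0 1)"
  show "compact {x + y | x y. x \<in> ?C K \<and> y \<in> ?C L}"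
    by (intro compact_sums) (use assms in \<open>auto simp: compact_op_def\<close>)
  show "K + L \<in> bounded_ops" using assms by (auto simp: compact_op_def bounded_ops_add)
  show "blinfun_apply (K + L) x \<in> {x + y | x y. x \<in> ?C K \<and> y \<in> ?C L}" if "norm x \<le> 1" for x
    using compact_opD[OF assms(1) that] compact_opD[OF assms(2) that] by (auto simp: blinfun.add_left)
qed

lemma compact_op_sum:
  assumes "\<And>i. i \<in> A \<Longrightarrow> compact_op (f i)"
  shows "compact_op (sum f A)"
  using assms by (induction A rule: infinite_finite_induct) (auto intro: compact_op_zero compact_op_add)

lemma compact_op_compose:
  assumes "compact_op K" "A \<in> bounded_ops" "B \<in> bounded_ops"
  shows "compact_op (B o\<^sub>L K o\<^sub>L A)"
proof (rule compact_opI)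
  let ?C = "closure (blinfun_apply K ` cball 0 1)"
  show "B o\<^sub>L K o\<^sub>L A \<in> bounded_ops"
    using assms by (auto simp: compact_op_def bounded_ops_compose)
  show "compact ((\<lambda>y. norm A *\<^sub>R blinfun_apply B y) ` ?C)"
    using assms(1) by (intro compact_continuous_image continuous_intros) (auto simp: compact_op_def)
  fix x :: ell2 assume x: "norm x \<le> 1"
  \<comment> \<open>Rescaling brings \<open>A x\<close> back into the unit ball. If
    \<open>norm A = 0\<close>, the inverse is zero by convention and both \<open>y\<close> and
    \<open>A x\<close> vanish.\<close>
  define y where "y = inverse (norm A) *\<^sub>R blinfun_apply A x"
  have nA: "norm (blinfun_apply A x) \<le> norm A"
    using norm_blinfun[of A x] mult_left_mono[OF x, of "norm A"] by simp
  then have "norm y \<le> 1"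
    by (cases "norm A = 0") (auto simp: y_def field_simps)
  moreover have "blinfun_apply A x = norm A *\<^sub>R y"
    by (cases "norm A = 0") (use nA in \<open>auto simp: y_def\<close>)
  ultimately show "blinfun_apply (B o\<^sub>L K o\<^sub>L A) x \<in> (\<lambda>y. norm A *\<^sub>R blinfun_apply B y) ` ?C"
    by (intro image_eqI[of _ _ "blinfun_apply K y"] compact_opD[OF assms(1)])
      (auto simp: blinfun.scaleR_right)
qed


lemma compact_op_compose_right: "compact_op K \<Longrightarrow> A \<in> bounded_ops \<Longrightarrow> compact_op (K o\<^sub>L A)"
  using compact_op_compose[OF _ _ bounded_ops_id, of K A]
  by (metis blinfun_apply_blinfun_compose blinfun_eqI id_blinfun.rep_eq)

section \<open>Schmidt decomposition\<close>

lemma compact_op_norm_attained: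
  assumes "compact_op L" "L \<noteq> 0"
  shows "\<exists>e. norm e = 1 \<and>
    blinfun_apply (hilbert_adjoint L) (blinfun_apply L e) = (norm L)\<^sup>2 *\<^sub>R e"
proof -
  define \<sigma> where "\<sigma> = norm L"
  let ?T = "blinfun_apply (hilbert_adjoint L)"
  have L: "L \<in> bounded_ops" using assms by (simp add: compact_op_def)
  have \<sigma>: "\<sigma> > 0" using assms by (simp add: \<sigma>_def)
  \<comment> \<open>For a maximizing sequence \<open>x\<^sub>n\<close>, \<open>L\<^sup>*L x\<^sub>n - \<sigma>\<^sup>2x\<^sub>n\<close> tends to zero; as \<open>L x\<^sub>n\<close> converges along a
    subsequence, so does \<open>x\<^sub>n\<close>.\<close>
  have "\<exists>x. norm x \<le> 1 \<and> \<sigma> - inverse (real (Suc n)) < norm (blinfun_apply L x)" for n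
  proof (rule ccontr)
    let ?c = "\<sigma> - inverse (real (Suc n))"
    assume "\<not> ?thesis"
    then have le: "norm (blinfun_apply L x) \<le> ?c" if "norm x \<le> 1" for x
      using that by force
    from le[of 0] have "0 \<le> ?c" by simp
    moreover have "norm (blinfun_apply L x) \<le> ?c * norm x" for x
    proof (cases "x = 0")
      case False
      then show ?thesis
        using le[of "inverse (norm x) *\<^sub>R x"] by (simp add: blinfun.scaleR_right field_simps)
    qed simp
    ultimately have "norm L \<le> ?c" by (rule norm_blinfun_bound)
    then show False by (simp add: \<sigma>_def)
  qed
  then obtain x where x: "\<And>n. norm (x n) \<le> 1"
    and x_lt: "\<And>n. \<sigma> - inverse (real (Suc n)) < norm (blinfun_apply L (x n))"
    by metis
  have "seq_compact (closure (blinfun_apply L ` cball 0 1))"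
    using assms(1) by (simp add: compact_op_def compact_eq_seq_compact_metric)
  then obtain y r where r: "strict_mono r"
    and y: "(\<lambda>n. blinfun_apply L (x (r n))) \<longlonglongrightarrow> y"
    using compact_opD[OF assms(1) x] by (elim seq_compactE[of _ "\<lambda>n. blinfun_apply L (x n)"]) (auto simp: o_def)
  have ny: "norm y = \<sigma>"
  proof (rule LIMSEQ_unique[OF tendsto_norm[OF y]])
    have le: "norm (blinfun_apply L (x n)) \<le> \<sigma>" for n
      using norm_blinfun[of L "x n"] mult_left_mono[OF x[of n], of \<sigma>] by (simp add: \<sigma>_def)
    have "(\<lambda>n. \<sigma> - inverse (real (Suc n))) \<longlonglongrightarrow> \<sigma> - 0"
      by (intro tendsto_diff tendsto_const LIMSEQ_inverse_real_of_nat)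
    then have "(\<lambda>n. norm (blinfun_apply L (x n))) \<longlonglongrightarrow> \<sigma>"
      using tendsto_sandwich[OF always_eventually[OF allI[OF less_imp_le[OF x_lt]]]
          always_eventually[OF allI[OF le]] _ tendsto_const] by simp
    from LIMSEQ_subseq_LIMSEQ[OF this r]
    show "(\<lambda>n. norm (blinfun_apply L (x (r n)))) \<longlonglongrightarrow> \<sigma>" by (simp add: o_def)
  qed
  \<comment> \<open>Expand the square and use that \<open>L\<^sup>*L v\<close> paired with
    \<open>v\<close> is the squared norm of \<open>L v\<close>. The right side vanishes as that norm
    approaches \<sigma>.\<close>
  have bound: "(norm (?T (blinfun_apply L v) - \<sigma>\<^sup>2 *\<^sub>R v))\<^sup>2 \<le> \<sigma>\<^sup>2 * \<sigma>\<^sup>2 - \<sigma>\<^sup>2 * (norm (blinfun_apply L v))\<^sup>2"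
    if v: "norm v \<le> 1" for v
  proof -
    let ?y = "blinfun_apply L v"
    have "v \<bullet> ?T ?y = (norm ?y)\<^sup>2"
      by (simp add: inner_eq_Re_cinner hilbert_adjoint(2)[OF L, symmetric] cinner_self)
    then have i: "?T ?y \<bullet> v = (norm ?y)\<^sup>2" by (simp add: inner_commute)
    have "(norm (?T ?y - \<sigma>\<^sup>2 *\<^sub>R v))\<^sup>2 = (norm (?T ?y))\<^sup>2 - 2 * \<sigma>\<^sup>2 * (norm ?y)\<^sup>2 + (\<sigma>\<^sup>2 * norm v)\<^sup>2"
      unfolding i[symmetric] unfolding power_mult_distrib power2_norm_eq_inner
      by (simp add: inner_diff_left inner_diff_right inner_commute[of v "?T ?y"] power2_eq_square[of "\<sigma>\<^sup>2"] algebra_simps)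
    also have "(norm (?T ?y))\<^sup>2 \<le> (\<sigma> * norm ?y)\<^sup>2"
      unfolding \<sigma>_def by (intro power_mono norm_hilbert_adjoint_apply L) auto
    also have "(\<sigma>\<^sup>2 * norm v)\<^sup>2 \<le> (\<sigma>\<^sup>2 * 1)\<^sup>2"
      using v by (intro power_mono mult_left_mono) auto
    finally show ?thesis by (simp add: power_mult_distrib power2_eq_square algebra_simps)
  qed
  have "(\<lambda>n. \<sigma>\<^sup>2 * \<sigma>\<^sup>2 - \<sigma>\<^sup>2 * (norm (blinfun_apply L (x (r n))))\<^sup>2) \<longlonglongrightarrow> \<sigma>\<^sup>2 * \<sigma>\<^sup>2 - \<sigma>\<^sup>2 * (norm y)\<^sup>2"
    by (intro tendsto_intros y)
  then have "(\<lambda>n. (norm (?T (blinfun_apply L (x (r n))) - \<sigma>\<^sup>2 *\<^sub>R x (r n)))\<^sup>2) \<longlonglongrightarrow> 0"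
    using tendsto_sandwich[OF always_eventually[OF allI[OF zero_le_power2]]
        always_eventually[OF allI[OF bound[OF x]]] tendsto_const] by (simp add: ny)
  from tendsto_real_sqrt[OF this]
  have "(\<lambda>n. ?T (blinfun_apply L (x (r n))) - \<sigma>\<^sup>2 *\<^sub>R x (r n)) \<longlonglongrightarrow> 0"
    by (simp add: tendsto_norm_zero_iff)
  from tendsto_diff[OF blinfun.tendsto[OF tendsto_const[of "hilbert_adjoint L"] y] this]
  have "(\<lambda>n. \<sigma>\<^sup>2 *\<^sub>R x (r n)) \<longlonglongrightarrow> ?T y" by simp
  from tendsto_scaleR[OF tendsto_const[of "inverse (\<sigma>\<^sup>2)"] this]
  have lim: "(\<lambda>n. x (r n)) \<longlonglongrightarrow> inverse (\<sigma>\<^sup>2) *\<^sub>R ?T y" using \<sigma> by simp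
  define e where "e = inverse (\<sigma>\<^sup>2) *\<^sub>R ?T y"
  have Le: "blinfun_apply L e = y"
    using blinfun.tendsto[OF tendsto_const lim] y LIMSEQ_unique unfolding e_def by blast
  have "norm e \<le> 1"
    using LIMSEQ_le_const2[OF tendsto_norm[OF lim]] x unfolding e_def by blast
  \<comment> \<open>Since \<open>L e = y\<close> has the maximal norm \<sigma>, a vector
    \<open>e\<close> in the unit ball must have norm one.\<close>
  moreover have "\<sigma> \<le> \<sigma> * norm e"
    using norm_blinfun[of L e] by (simp add: Le ny \<sigma>_def)
  ultimately have "norm e = 1" using \<sigma> by simp
  moreover have "?T (blinfun_apply L e) = \<sigma>\<^sup>2 *\<^sub>R e" using \<sigma> by (simp only: Le) (simp add: e_def)
  ultimately show ?thesis unfolding \<sigma>_def by blast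
qed

text \<open>A right singular vector for the largest singular value. Taking the zero vector when
  \<open>L = 0\<close> lets the recursion below continue beyond the rank of an operator.\<close>

definition top_vector :: "(ell2 \<Rightarrow>\<^sub>L ell2) \<Rightarrow> ell2" where
  "top_vector L = (SOME e. norm e = (if L = 0 then 0 else 1) \<and>
    blinfun_apply (hilbert_adjoint L) (blinfun_apply L e) = (norm L)\<^sup>2 *\<^sub>R e)"

lemma top_vector:
  assumes "compact_op L"
  shows "norm (top_vector L) = (if L = 0 then 0 else 1)"
    and "blinfun_apply (hilbert_adjoint L) (blinfun_apply L (top_vector L)) = (norm L)\<^sup>2 *\<^sub>R top_vector L"
proof -
  have "\<exists>e. norm e = (if L = 0 then 0 else 1) \<and>
    blinfun_apply (hilbert_adjoint L) (blinfun_apply L e) = (norm L)\<^sup>2 *\<^sub>R e"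
    using compact_op_norm_attained[OF assms] by (cases "L = 0") auto
  from someI_ex[OF this] show "norm (top_vector L) = (if L = 0 then 0 else 1)"
    and "blinfun_apply (hilbert_adjoint L) (blinfun_apply L (top_vector L)) = (norm L)\<^sup>2 *\<^sub>R top_vector L"
    unfolding top_vector_def by blast+
qed

text \<open>Each step projects away the current top singular vector. For compact \<open>K\<close>
  the norms of the successive remainders turn out to be the singular values in order.\<close>

primrec deflation :: "(ell2 \<Rightarrow>\<^sub>L ell2) \<Rightarrow> nat \<Rightarrow> (ell2 \<Rightarrow>\<^sub>L ell2)" where
  "deflation K 0 = K"
| "deflation K (Suc n) = (let L = deflation K n; e = top_vector L in L o\<^sub>L (id_blinfun - ket_bra e e))"

text \<open>The squared norm drops by the squared modulus of \<open>cinner x e\<close> times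
  \<open>2 - (norm e)\<^sup>2\<close>, which is nonnegative. The form \<open>norm e \<le> 1\<close>
  covers unit and zero top vectors at once.\<close>

lemma norm_diff_projection_le:
  assumes "norm e \<le> 1"
  shows "norm (x - scaleC (cinner x e) e) \<le> norm x"
proof -
  let ?c = "cmod (cinner x e)"
  have "cinner (x - scaleC (cinner x e) e) (x - scaleC (cinner x e) e)
      = cinner x x - cinner x e * cnj (cinner x e) * (2 - cinner e e)"
    by (simp add: cinner.diff_left cinner.diff_right cinner_scaleC_left cinner_scaleC_right
        cinner_commute[of e x] algebra_simps)
  also have "\<dots> = complex_of_real ((norm x)\<^sup>2 - ?c\<^sup>2 * (2 - (norm e)\<^sup>2))"
    by (simp add: cinner_self complex_norm_square[symmetric])
  finally have "(norm (x - scaleC (cinner x e) e))\<^sup>2 = (norm x)\<^sup>2 - ?c\<^sup>2 * (2 - (norm e)\<^sup>2)"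
    unfolding cinner_self of_real_eq_iff .
  moreover have "(norm e)\<^sup>2 \<le> 1" using assms by (simp add: power_le_one)
  ultimately have "(norm (x - scaleC (cinner x e) e))\<^sup>2 \<le> (norm x)\<^sup>2" by simp
  then show ?thesis by (rule power2_le_imp_le) simp
qed

text \<open>Vectors \<open>e n\<close> with \<open>s n = 0\<close> are zero, so that finite rank needs no separate treatment.\<close>

locale schmidt_decomposition =
  fixes K :: "ell2 \<Rightarrow>\<^sub>L ell2" and e :: "nat \<Rightarrow> ell2" and s :: "nat \<Rightarrow> real"
  assumes bounded_op: "K \<in> bounded_ops"
    and orthogonal: "m \<noteq> n \<Longrightarrow> cinner (e m) (e n) = 0"
    and norm_e: "norm (e n) = (if s n = 0 then 0 else 1)"
    and image_orthogonal: "m \<noteq> n \<Longrightarrow> cinner (blinfun_apply K (e m)) (blinfun_apply K (e n)) = 0"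
    and norm_image: "norm (blinfun_apply K (e n)) = s n"
    and s_decseq: "decseq s" and s_tendsto: "s \<longlonglongrightarrow> 0" and s_0: "s 0 = norm K"
    and expansion: "(\<lambda>n. scaleC (cinner x (e n)) (blinfun_apply K (e n))) sums blinfun_apply K x"

text \<open>The vectors are the top vectors met during deflation and the values are the norms of the
  remainders. The remainder \<open>L n\<close> is \<open>K\<close> minus the first \<open>n\<close>
  terms of the expansion, so convergence reduces to \<open>s\<close> tending to zero.\<close>

lemma schmidt_decomposition_exists:
  assumes "compact_op K"
  shows "\<exists>e s. schmidt_decomposition K e s"
proof -
  define L where "L = deflation K"
  define e where "e n = top_vector (L n)" for n
  define s where "s n = norm (L n)" for n
  have K: "K \<in> bounded_ops" using assms by (simp add: compact_op_def)
  have L0: "L 0 = K" by (simp add: L_def)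
  have LS: "L (Suc n) = L n o\<^sub>L (id_blinfun - ket_bra (e n) (e n))" for n
    by (simp add: L_def e_def Let_def)
  have b: "id_blinfun - ket_bra u u \<in> bounded_ops" for u
    using ket_bra by (simp add: bounded_ops_def blinfun.diff_left ell2.scale_right_diff_distrib)
  have compact: "compact_op (L n)" for n
    by (induction n) (simp_all add: L0 LS assms compact_op_compose_right b)
  have Lb: "L n \<in> bounded_ops" for n using compact by (simp add: compact_op_def)
  have LSx: "blinfun_apply (L (Suc n)) x = blinfun_apply (L n) x - scaleC (cinner x (e n)) (blinfun_apply (L n) (e n))" for n x
    by (simp add: LS blinfun.diff_left blinfun.diff_right ket_bra bounded_opsD[OF Lb])
  have ne: "norm (e n) = (if s n = 0 then 0 else 1)" for n
    using top_vector(1)[OF compact[of n]] by (simp add: e_def s_def)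
  \<comment> \<open>The eigenvalue equation in weak form; the orthogonality of the vectors and of
    their images both follow from it.\<close>
  have eig: "cinner (blinfun_apply (L n) x) (blinfun_apply (L n) (e n)) = complex_of_real ((s n)\<^sup>2) * cinner x (e n)" for n x
    using top_vector(2)[OF compact[of n]]
    by (simp add: hilbert_adjoint(2)[OF Lb] e_def[symmetric] s_def[symmetric] cinner.scaleR_right scaleR_conv_of_real)
  have decs: "s (Suc n) \<le> s n" for n
    unfolding s_def
  proof (rule norm_blinfun_bound)
    fix x
    have "blinfun_apply (L (Suc n)) x = blinfun_apply (L n) (x - scaleC (cinner x (e n)) (e n))"
      by (simp add: LSx blinfun.diff_right bounded_opsD[OF Lb])
    also have "norm \<dots> \<le> norm (L n) * norm (x - scaleC (cinner x (e n)) (e n))" by (rule norm_blinfun)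
    also have "\<dots> \<le> norm (L n) * norm x"
      by (intro mult_left_mono norm_diff_projection_le) (auto simp: ne)
    finally show "norm (blinfun_apply (L (Suc n)) x) \<le> norm (L n) * norm x" .
  qed simp
  then have dec: "decseq s" by (simp add: decseq_Suc_iff)
  \<comment> \<open>Remainders annihilate all earlier vectors. By \<open>eig\<close>, a new top
    vector is then orthogonal to them, or \<open>s n = 0\<close> and the new vector is zero.\<close>
  have kill: "blinfun_apply (L n) (e k) = 0" if "k < n" for n k
    using that
  proof (induction n)
    case (Suc n)
    show ?case
    proof (cases "k = n")
      case True
      have "s n = 0 \<or> cinner (e n) (e n) = 1" by (simp add: cinner_self ne)
      then show ?thesis using True ne[of n] by (cases "s n = 0") (auto simp: LSx)
    next
      case False
      then have *: "blinfun_apply (L n) (e k) = 0" using Suc by simp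
      then have "complex_of_real ((s n)\<^sup>2) * cinner (e k) (e n) = 0"
        using eig[of n "e k"] by (simp add: cinner.zero_left)
      then have "s n = 0 \<or> cinner (e k) (e n) = 0" by simp
      then show ?thesis using * ne[of n] by (auto simp: LSx)
    qed
  qed simp
  have orth_less: "cinner (e k) (e n) = 0" if "k < n" for k n
  proof -
    have "complex_of_real ((s n)\<^sup>2) * cinner (e k) (e n) = 0"
      using eig[of n "e k"] kill[OF that] by (simp add: cinner.zero_left)
    then show ?thesis using ne[of n] by (auto simp: cinner.zero_right)
  qed
  have orth: "cinner (e m) (e n) = 0" if "m \<noteq> n" for m n
    using that orth_less[of m n] orth_less[of n m] cinner_commute[of "e m" "e n"] by (cases "m < n") auto
  \<comment> \<open>The terms already subtracted involve earlier vectors only and vanish at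
    \<open>e n\<close>, so statements about remainders become statements about
    \<open>K\<close>.\<close>
  have Le: "blinfun_apply (L m) (e n) = blinfun_apply K (e n)" if "m \<le> n" for m n
    using that by (induction m) (auto simp: L0 LSx orth)
  have Ksum: "blinfun_apply K x - blinfun_apply (L n) x = (\<Sum>k<n. scaleC (cinner x (e k)) (blinfun_apply K (e k)))" for x n
    by (induction n) (simp_all add: L0 LSx Le algebra_simps)
  have norm_image: "norm (blinfun_apply K (e n)) = s n" for n
  proof -
    have "cinner (blinfun_apply K (e n)) (blinfun_apply K (e n)) = complex_of_real ((s n)\<^sup>2) * cinner (e n) (e n)"
      using eig[of n "e n"] by (simp add: Le)
    then have "complex_of_real ((norm (blinfun_apply K (e n)))\<^sup>2) = complex_of_real ((s n)\<^sup>2)"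
      by (simp add: cinner_self ne split: if_splits)
    then have "(norm (blinfun_apply K (e n)))\<^sup>2 = (s n)\<^sup>2" by (simp only: of_real_eq_iff)
    then show ?thesis by (subst (asm) power2_eq_iff_nonneg) (simp_all add: s_def)
  qed
  have im_orth_less: "cinner (blinfun_apply K (e n)) (blinfun_apply K (e m)) = 0" if "m < n" for m n
    using eig[of m "e n"] that by (simp add: Le orth)
  have im_orth: "cinner (blinfun_apply K (e m)) (blinfun_apply K (e n)) = 0" if "m \<noteq> n" for m n
    using that im_orth_less[of m n] im_orth_less[of n m]
      cinner_commute[of "blinfun_apply K (e m)" "blinfun_apply K (e n)"] by (cases "m < n") auto
  have s_tendsto: "s \<longlonglongrightarrow> 0"
    \<comment> \<open>Otherwise the orthogonal images \<open>K e\<^sub>n\<close> stay apart and have no convergent subsequence.\<close>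
  proof -
    obtain l where l: "s \<longlonglongrightarrow> l" "\<And>n. l \<le> s n"
      using decseq_convergent[OF dec, of 0] by (auto simp: s_def)
    have l0: "0 \<le> l" by (rule LIMSEQ_le_const[OF l(1)]) (auto simp: s_def)
    have "seq_compact (closure (blinfun_apply K ` cball 0 1))"
      using assms by (simp add: compact_op_def compact_eq_seq_compact_metric)
    moreover have "blinfun_apply K (e n) \<in> closure (blinfun_apply K ` cball 0 1)" for n
      by (intro compact_opD assms) (simp add: ne)
    ultimately obtain y r where r: "strict_mono r" and y: "(\<lambda>n. blinfun_apply K (e (r n))) \<longlonglongrightarrow> y"
      by (elim seq_compactE[of _ "\<lambda>n. blinfun_apply K (e n)"]) (auto simp: o_def)
    have lim: "(\<lambda>n. (norm (blinfun_apply K (e (r (Suc n))) - blinfun_apply K (e (r n))))\<^sup>2) \<longlonglongrightarrow> (norm (y - y))\<^sup>2"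
      by (intro tendsto_intros y LIMSEQ_Suc[OF y])
    have ge: "l\<^sup>2 \<le> (norm (blinfun_apply K (e (r (Suc n))) - blinfun_apply K (e (r n))))\<^sup>2" for n
    proof -
      have neq: "r n \<noteq> r (Suc n)" using r by (simp add: strict_mono_eq)
      have "(norm (blinfun_apply K (e (r (Suc n))) - blinfun_apply K (e (r n))))\<^sup>2 = (s (r (Suc n)))\<^sup>2 + (s (r n))\<^sup>2"
        using im_orth[OF neq] im_orth[OF neq[symmetric]] unfolding norm_image[symmetric]
        by (simp add: power2_norm_eq_inner inner_diff_left inner_diff_right)
          (simp add: inner_eq_Re_cinner)
      moreover have "l\<^sup>2 \<le> (s (r n))\<^sup>2" using l(2) l0 by (intro power_mono) auto
      ultimately show ?thesis by (simp add: add_increasing)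
    qed
    have "l\<^sup>2 \<le> (norm (y - y))\<^sup>2" by (rule LIMSEQ_le_const[OF lim]) (use ge in blast)
    then show ?thesis using l by simp
  qed
  have "(\<lambda>n. scaleC (cinner x (e n)) (blinfun_apply K (e n))) sums blinfun_apply K x" for x
  proof -
    have "(\<lambda>n. blinfun_apply (L n) x) \<longlonglongrightarrow> 0"
    proof (rule Lim_null_comparison)
      show "\<forall>\<^sub>F n in sequentially. norm (blinfun_apply (L n) x) \<le> s n * norm x"
        by (simp add: s_def norm_blinfun)
      show "(\<lambda>n. s n * norm x) \<longlonglongrightarrow> 0" using tendsto_mult_right[OF s_tendsto, of "norm x"] by simp
    qed
    from tendsto_diff[OF tendsto_const[of "blinfun_apply K x"] this]
    show ?thesis unfolding sums_def Ksum by simp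
  qed
  then have "schmidt_decomposition K e s"
    by unfold_locales (simp_all add: K orth ne im_orth norm_image dec s_tendsto s_def L0)
  then show ?thesis by blast
qed


section \<open>Uniqueness of the singular values\<close>

text \<open>
  At the first index \<open>n\<close> where \<open>t n < s n\<close>, say, the value \<open>s n\<close> occurs less often in \<open>t\<close> than in \<open>s\<close>.
\<close>

lemma decseq_eqI_card:
  fixes s t :: "nat \<Rightarrow> real"
  assumes "decseq s" "decseq t" "\<And>n. 0 \<le> s n" "\<And>n. 0 \<le> t n"
    and "\<And>\<mu>. 0 < \<mu> \<Longrightarrow> finite {n. s n = \<mu>}" "\<And>\<mu>. 0 < \<mu> \<Longrightarrow> finite {n. t n = \<mu>}"
    and "\<And>\<mu>. 0 < \<mu> \<Longrightarrow> card {n. s n = \<mu>} = card {n. t n = \<mu>}"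
  shows "s = t"
proof (rule ccontr)
  assume "s \<noteq> t"
  then have ex: "\<exists>n. s n \<noteq> t n" by auto
  define n where "n = (LEAST n. s n \<noteq> t n)"
  have n: "s n \<noteq> t n" using LeastI_ex[OF ex] by (simp add: n_def)
  have eq: "s k = t k" if "k < n" for k using that not_less_Least by (force simp: n_def)
  \<comment> \<open>Stated for a generic pair, so that it serves for either direction of the
    inequality between \<open>s n\<close> and \<open>t n\<close>.\<close>
  have False if dec: "decseq t'" and nn: "0 \<le> t' n" and fin: "\<And>\<mu>. 0 < \<mu> \<Longrightarrow> finite {n. s' n = \<mu>}"
    and card: "\<And>\<mu>. 0 < \<mu> \<Longrightarrow> card {n. s' n = \<mu>} = card {n. t' n = \<mu>}"
    and lt: "t' n < s' n" and eq: "\<And>k. k < n \<Longrightarrow> s' k = t' k" for s' t' :: "nat \<Rightarrow> real"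
  proof -
    have pos: "0 < s' n" using nn lt by simp
    have "{k. t' k = s' n} \<subseteq> {k. s' k = s' n} - {n}"
    proof
      fix k assume k: "k \<in> {k. t' k = s' n}"
      have "k < n"
      proof (rule ccontr)
        assume "\<not> k < n"
        then have "t' k \<le> t' n" by (intro decseqD[OF dec]) simp
        then show False using k lt by simp
      qed
      then show "k \<in> {k. s' k = s' n} - {n}" using k eq by auto
    qed
    then have "{k. t' k = s' n} \<subset> {k. s' k = s' n}" by blast
    from psubset_card_mono[OF fin[OF pos] this] show False using card[OF pos] by simp
  qed
  from this[of t s] this[of s t] n show False
    using assms eq by (metis linorder_neqE_linordered_idom)
qed

context schmidt_decomposition
begin

lemma s_nonneg: "0 \<le> s n"
  by (metis norm_ge_zero norm_image)

text \<open>The images of the \<open>e k\<close> are mutually orthogonal, so pairing the expansion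
  with one of them leaves a single term. This recovers the eigenvector equation for
  \<open>K\<^sup>*K\<close> from the abstract decomposition.\<close>

lemma cinner_image:
  "cinner (blinfun_apply K x) (blinfun_apply K (e n)) = complex_of_real ((s n)\<^sup>2) * cinner x (e n)"
proof -
  let ?g = "\<lambda>k. blinfun_apply K (e k)"
  have "(\<lambda>k. cinner (scaleC (cinner x (e k)) (?g k)) (?g n)) sums cinner (blinfun_apply K x) (?g n)"
    by (rule bounded_linear.sums[OF cinner.bounded_linear_left expansion])
  moreover have "(\<lambda>k. cinner (scaleC (cinner x (e k)) (?g k)) (?g n))
      = (\<lambda>k. if k = n then complex_of_real ((s k)\<^sup>2) * cinner x (e k) else 0)"
    by (auto simp: fun_eq_iff cinner_scaleC_left image_orthogonal cinner_self norm_image)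
  ultimately show ?thesis
    using sums_single[of n "\<lambda>k. complex_of_real ((s k)\<^sup>2) * cinner x (e k)"]
    by (intro sums_unique2) simp_all
qed

lemma adjoint_image:
  "blinfun_apply (hilbert_adjoint K) (blinfun_apply K (e n)) = scaleC (complex_of_real ((s n)\<^sup>2)) (e n)"
  by (rule cinner_eqI)
    (simp add: hilbert_adjoint(2)[OF bounded_op, symmetric] cinner_image cinner_scaleC_right)

lemma finite_level: "0 < \<mu> \<Longrightarrow> finite {n. s n = \<mu>}"
proof -
  assume "0 < \<mu>"
  then obtain N where N: "\<And>n. N \<le> n \<Longrightarrow> s n < \<mu>"
    using order_tendstoD(2)[OF s_tendsto] by (auto simp: eventually_sequentially)
  have "{n. s n = \<mu>} \<subseteq> {..<N}"
    using N by (force simp: not_le[symmetric])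
  then show ?thesis by (rule finite_subset) simp
qed

text \<open>An eigenvector for a positive eigenvalue is orthogonal to every \<open>e n\<close>
  belonging to another value, so its expansion reduces to the finitely many terms with
  \<open>s n = \<mu>\<close>.\<close>

lemma eigenspace_eq_span:
  assumes "0 < \<mu>"
  shows "eigenspace (hilbert_adjoint K o\<^sub>L K) (\<mu>\<^sup>2) = ell2.span (e ` {n. s n = \<mu>})"
proof
  let ?A = "hilbert_adjoint K o\<^sub>L K"
  have A: "?A \<in> bounded_ops" by (intro bounded_ops_compose hilbert_adjoint bounded_op)
  show "ell2.span (e ` {n. s n = \<mu>}) \<subseteq> eigenspace ?A (\<mu>\<^sup>2)"
  proof (rule ell2.span_minimal)
    show "e ` {n. s n = \<mu>} \<subseteq> eigenspace ?A (\<mu>\<^sup>2)"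
      by (auto simp: eigenspace_def adjoint_image)
    show "ell2.subspace (eigenspace ?A (\<mu>\<^sup>2))"
    proof (rule ell2.subspaceI)
      fix c x assume "x \<in> eigenspace ?A (\<mu>\<^sup>2)"
      then show "scaleC c x \<in> eigenspace ?A (\<mu>\<^sup>2)"
        unfolding eigenspace_def mem_Collect_eq bounded_opsD[OF A] by (simp add: mult.commute)
    qed (simp_all add: eigenspace_def blinfun.add_right ell2.scale_right_distrib)
  qed
  show "eigenspace ?A (\<mu>\<^sup>2) \<subseteq> ell2.span (e ` {n. s n = \<mu>})"
  proof
    let ?F = "{n. s n = \<mu>}" and ?T = "blinfun_apply (hilbert_adjoint K)"
    fix x assume "x \<in> eigenspace ?A (\<mu>\<^sup>2)"
    then have x: "?T (blinfun_apply K x) = scaleC (complex_of_real (\<mu>\<^sup>2)) x"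
      by (simp add: eigenspace_def)
    \<comment> \<open>Evaluating \<open>cinner (e n) (K\<^sup>*K x)\<close> in two ways multiplies
      \<open>cinner (e n) x\<close> by either of two squares, which differ because
      \<open>s n\<close> and \<mu> are distinct and nonnegative.\<close>
    have zero: "cinner x (e n) = 0" if "s n \<noteq> \<mu>" for n
    proof -
      have "complex_of_real ((s n)\<^sup>2) * cinner (e n) x = complex_of_real (\<mu>\<^sup>2) * cinner (e n) x"
      proof -
        have "cinner (e n) (?T (blinfun_apply K x)) = cnj (cinner (blinfun_apply K x) (blinfun_apply K (e n)))"
          by (simp add: hilbert_adjoint(2)[OF bounded_op, symmetric] cinner_commute[of _ "blinfun_apply K (e n)"])
        then show ?thesis
          by (auto simp: x cinner_image cinner_scaleC_right cinner_commute[of x "e n"])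
      qed
      then have "complex_of_real ((s n)\<^sup>2) = complex_of_real (\<mu>\<^sup>2) \<or> cinner (e n) x = 0"
        unfolding mult_cancel_right by blast
      moreover have "(s n)\<^sup>2 \<noteq> \<mu>\<^sup>2" using that assms s_nonneg[of n] by (simp add: power2_eq_iff_nonneg)
      ultimately have "cinner (e n) x = 0" unfolding of_real_eq_iff by blast
      then show ?thesis by (subst cinner_commute) simp
    qed
    have "(\<lambda>n. ?T (scaleC (cinner x (e n)) (blinfun_apply K (e n)))) sums ?T (blinfun_apply K x)"
      by (rule bounded_linear.sums[OF blinfun.bounded_linear_right expansion])
    moreover have "(\<lambda>n. ?T (scaleC (cinner x (e n)) (blinfun_apply K (e n)))) sums
      (\<Sum>n\<in>?F. ?T (scaleC (cinner x (e n)) (blinfun_apply K (e n))))"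
      by (rule sums_finite[OF finite_level[OF assms]]) (simp add: zero)
    ultimately have "scaleC (complex_of_real (\<mu>\<^sup>2)) x
        = (\<Sum>n\<in>?F. ?T (scaleC (cinner x (e n)) (blinfun_apply K (e n))))"
      unfolding x by (rule sums_unique2)
    also have "\<dots> = (\<Sum>n\<in>?F. scaleC (cinner x (e n) * complex_of_real ((s n)\<^sup>2)) (e n))"
      by (simp add: bounded_opsD[OF hilbert_adjoint(1)[OF bounded_op]] adjoint_image)
    also have "\<dots> \<in> ell2.span (e ` ?F)"
      by (intro ell2.span_sum ell2.span_scale ell2.span_base) simp
    finally have "scaleC (inverse (complex_of_real (\<mu>\<^sup>2))) (scaleC (complex_of_real (\<mu>\<^sup>2)) x) \<in> ell2.span (e ` ?F)"
      by (rule ell2.span_scale)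
    then show "x \<in> ell2.span (e ` ?F)" using assms by simp
  qed
qed

text \<open>For positive \<mu> the spanning vectors are orthonormal, hence distinct and independent,
  and the dimension counts their indices.\<close>

lemma dim_eigenspace:
  assumes "0 < \<mu>"
  shows "ell2.dim (eigenspace (hilbert_adjoint K o\<^sub>L K) (\<mu>\<^sup>2)) = card {n. s n = \<mu>}"
proof -
  let ?F = "{n. s n = \<mu>}"
  have self: "cinner (e n) (e n) = 1" if "n \<in> ?F" for n
    using that assms by (simp add: cinner_self norm_e)
  have inj: "inj_on e ?F"
    using self orthogonal by (intro inj_onI) (metis zero_neq_one)
  have "\<not> ell2.dependent (e ` ?F)"
  proof
    assume "ell2.dependent (e ` ?F)"
    then obtain n where n: "n \<in> ?F" "e n \<in> ell2.span (e ` ?F - {e n})"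
      by (auto simp: ell2.dependent_def)
    have "ell2.span (e ` ?F - {e n}) \<subseteq> {x. cinner x (e n) = 0}"
    proof (rule ell2.span_minimal)
      show "e ` ?F - {e n} \<subseteq> {x. cinner x (e n) = 0}" by (auto intro: orthogonal)
      show "ell2.subspace {x. cinner x (e n) = 0}"
        by (rule ell2.subspaceI) (simp_all add: cinner.zero_left cinner_add_left cinner_scaleC_left)
    qed
    then show False using n self[OF n(1)] by auto
  qed
  then show ?thesis
    unfolding eigenspace_eq_span[OF assms]
    by (rule trans[OF ell2.dim_span_eq_card_independent card_image[OF inj]])
qed

text \<open>The dimension count shows that \<open>s\<close> meets the defining conditions, and the
  counting lemma gives uniqueness. Singular values can now be read off from any Schmidt
  decomposition.\<close>

lemma singular_values_eq: "singular_values K = s"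
  unfolding singular_values_def
proof (rule the_equality)
  show "decseq s \<and> (\<forall>n. 0 \<le> s n) \<and> (\<forall>\<mu>>0. finite {n. s n = \<mu>} \<and>
      card {n. s n = \<mu>} = ell2.dim (eigenspace (hilbert_adjoint K o\<^sub>L K) (\<mu>\<^sup>2)))"
    using s_decseq s_nonneg finite_level dim_eigenspace by auto
  fix t assume t: "decseq t \<and> (\<forall>n. 0 \<le> t n) \<and> (\<forall>\<mu>>0. finite {n. t n = \<mu>} \<and>
      card {n. t n = \<mu>} = ell2.dim (eigenspace (hilbert_adjoint K o\<^sub>L K) (\<mu>\<^sup>2)))"
  show "t = s"
    by (rule decseq_eqI_card) (use t s_decseq s_nonneg finite_level dim_eigenspace in auto)
qed

end

section \<open>Nuclear representations and the trace\<close>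

text \<open>Here \<open>z\<close> is the truncated Fourier expansion of \<open>x\<close>.
  Orthogonality and norms at most one give a squared norm of \<open>z\<close> at most
  \<open>?S\<close>, which is enough when some vectors are zero; then expand the nonnegative square
  of \<open>norm (x - z)\<close>.\<close>

lemma Bessel_inequality:
  assumes "\<And>m n. m \<noteq> n \<Longrightarrow> cinner (u m) (u n) = 0" "\<And>n. norm (u n) \<le> 1"
  shows "(\<Sum>n<N::nat. (cmod (cinner x (u n)))\<^sup>2) \<le> (norm x)\<^sup>2"
proof -
  define z where "z = (\<Sum>n<N. scaleC (cinner x (u n)) (u n))"
  let ?S = "\<Sum>n<N. (cmod (cinner x (u n)))\<^sup>2"
  have zu: "cinner z (u n) = cinner x (u n) * cinner (u n) (u n)" if "n < N" for n
  proof -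
    have "cinner z (u n) = (\<Sum>k<N. if k = n then cinner x (u n) * cinner (u n) (u n) else 0)"
      unfolding z_def cinner.sum_left by (intro sum.cong) (auto simp: cinner_scaleC_left assms(1))
    then show ?thesis using that by simp
  qed
  have xz: "cinner x z = complex_of_real ?S"
    by (simp add: z_def cinner.sum_right cinner_scaleC_right complex_norm_square mult.commute del: of_real_power)
  have "cinner z z = (\<Sum>n<N. cnj (cinner x (u n)) * cinner z (u n))"
    by (subst (2) z_def) (simp add: cinner.sum_right cinner_scaleC_right)
  also have "\<dots> = (\<Sum>n<N. complex_of_real ((cmod (cinner x (u n)))\<^sup>2 * (norm (u n))\<^sup>2))"
    by (intro sum.cong) (simp_all add: zu cinner_self complex_norm_square mult_ac del: of_real_power)
  finally have "complex_of_real ((norm z)\<^sup>2) = complex_of_real (\<Sum>n<N. (cmod (cinner x (u n)))\<^sup>2 * (norm (u n))\<^sup>2)"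
    by (simp only: cinner_self of_real_sum)
  then have "(norm z)\<^sup>2 = (\<Sum>n<N. (cmod (cinner x (u n)))\<^sup>2 * (norm (u n))\<^sup>2)" by (simp only: of_real_eq_iff)
  also have "\<dots> \<le> ?S"
    by (intro sum_mono mult_left_le power_le_one assms(2)) auto
  finally have "(norm z)\<^sup>2 \<le> ?S" .
  moreover have "(norm (x - z))\<^sup>2 = (norm x)\<^sup>2 - 2 * ?S + (norm z)\<^sup>2"
  proof -
    have "x \<bullet> z = ?S" by (simp only: inner_eq_Re_cinner xz Re_complex_of_real)
    then show ?thesis
      unfolding power2_norm_eq_inner by (simp add: inner_diff_left inner_diff_right inner_commute)
  qed
  moreover have "0 \<le> (norm (x - z))\<^sup>2" by simp
  ultimately show ?thesis by linarith
qed

text \<open>Cauchy-Schwarz over the index, then Bessel in each factor. Used with coordinate vectors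
  for traces and with singular vectors for sums of singular values.\<close>

lemma sum_cinner_mult_le:
  assumes "\<And>m n. m \<noteq> n \<Longrightarrow> cinner (u m) (u n) = 0" "\<And>n. norm (u n) \<le> 1"
    and "\<And>m n. m \<noteq> n \<Longrightarrow> cinner (v m) (v n) = 0" "\<And>n. norm (v n) \<le> 1"
  shows "(\<Sum>n<N::nat. cmod (cinner a (u n)) * cmod (cinner b (v n))) \<le> norm a * norm b"
proof -
  have "(\<Sum>n<N. \<bar>cmod (cinner a (u n))\<bar> * \<bar>cmod (cinner b (v n))\<bar>)
    \<le> L2_set (\<lambda>n. cmod (cinner a (u n))) {..<N} * L2_set (\<lambda>n. cmod (cinner b (v n))) {..<N}"
    by (rule L2_set_mult_ineq)
  also have "\<dots> \<le> norm a * norm b"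
    unfolding L2_set_def using Bessel_inequality[OF assms(1,2)] Bessel_inequality[OF assms(3,4)]
    by (intro mult_mono real_le_lsqrt) (auto intro: sum_nonneg)
  finally show ?thesis by simp
qed

text \<open>No orthogonality is imposed, so the notion survives composition with bounded operators
  on either side, unlike a Schmidt decomposition.\<close>

definition nuclear_rep :: "(ell2 \<Rightarrow>\<^sub>L ell2) \<Rightarrow> (nat \<Rightarrow> ell2) \<Rightarrow> (nat \<Rightarrow> ell2) \<Rightarrow> bool" where
  "nuclear_rep L a b \<longleftrightarrow> summable (\<lambda>k. norm (a k) * norm (b k)) \<and>
    (\<forall>x. (\<lambda>k. scaleC (cinner x (a k)) (b k)) sums blinfun_apply L x)"

lemma nuclear_rep_cinner_sums:
  assumes "nuclear_rep L a b"
  shows "(\<lambda>k. cinner x (a k) * cinner (b k) y) sums cinner (blinfun_apply L x) y"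
proof -
  have "(\<lambda>k. scaleC (cinner x (a k)) (b k)) sums blinfun_apply L x"
    using assms by (simp add: nuclear_rep_def)
  from bounded_linear.sums[OF cinner.bounded_linear_left[of y] this]
  show ?thesis by (simp add: cinner_scaleC_left)
qed

text \<open>The trace is a double series. For fixed \<open>k\<close> its sum over the coordinates is
  \<open>cinner (b k) (a k)\<close>, and the partial sums are bounded by
  \<open>norm (a k) * norm (b k)\<close> uniformly in their length, so Tannery's theorem allows the
  order of summation to be exchanged.\<close>

lemma nuclear_rep_trace:
  assumes "nuclear_rep L a b"
  shows "(\<lambda>n. cinner (blinfun_apply L (unit_vec n)) (unit_vec n)) sums (\<Sum>k. cinner (b k) (a k))"
    and "op_trace L = (\<Sum>k. cinner (b k) (a k))"
    and "summable (\<lambda>k. cinner (b k) (a k))"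
proof -
  define F where "F k n = cinner (unit_vec n) (a k) * cinner (b k) (unit_vec n)" for k n
  have Fn: "(\<lambda>k. F k n) sums cinner (blinfun_apply L (unit_vec n)) (unit_vec n)" for n
    unfolding F_def by (rule nuclear_rep_cinner_sums[OF assms])
  have Fk: "(\<lambda>n. F k n) sums cinner (b k) (a k)" for k
    using cinner_sums[of "b k" "a k"]
    by (simp add: F_def cinner_commute[of "unit_vec _" "a k"] cinner_unit_vec mult.commute)
  have unit_orth: "cinner (unit_vec m) (unit_vec n) = 0" if "m \<noteq> n" for m n
    using that by (simp add: cinner_unit_vec unit_vec.rep_eq)
  have bound: "norm (\<Sum>n<N. F k n) \<le> norm (a k) * norm (b k)" for k N
  proof -
    have "norm (\<Sum>n<N. F k n) \<le> (\<Sum>n<N. cmod (cinner (a k) (unit_vec n)) * cmod (cinner (b k) (unit_vec n)))"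
      by (rule sum_norm_le) (simp add: F_def norm_mult cinner_commute[of "a k" "unit_vec _"])
    also have "\<dots> \<le> norm (a k) * norm (b k)"
      by (rule sum_cinner_mult_le) (simp_all add: unit_orth norm_unit_vec)
    finally show ?thesis .
  qed
  have sm: "summable (\<lambda>k. norm (a k) * norm (b k))" using assms by (simp add: nuclear_rep_def)
  have eq: "(\<Sum>k. \<Sum>n<N. F k n) = (\<Sum>n<N. cinner (blinfun_apply L (unit_vec n)) (unit_vec n))" for N
    using sums_sum[of "{..<N}" "\<lambda>n k. F k n", OF Fn] by (simp add: sums_iff)
  have T: "eventually (\<lambda>N. summable (\<lambda>k. norm (\<Sum>n<N. F k n))) sequentially \<and>
      summable (\<lambda>k. norm (cinner (b k) (a k))) \<and>
      (\<lambda>N. \<Sum>k. \<Sum>n<N. F k n) \<longlonglongrightarrow> (\<Sum>k. cinner (b k) (a k))"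
    by (rule tannerys_theorem[where M = "\<lambda>k. norm (a k) * norm (b k)"])
      (use Fk bound sm in \<open>auto simp: sums_def case_prod_unfold\<close>)
  then show sums: "(\<lambda>n. cinner (blinfun_apply L (unit_vec n)) (unit_vec n)) sums (\<Sum>k. cinner (b k) (a k))"
    by (simp add: sums_def eq)
  then show "op_trace L = (\<Sum>k. cinner (b k) (a k))"
    unfolding op_trace_def by (rule sums_unique[symmetric])
  show "summable (\<lambda>k. cinner (b k) (a k))" using conjunct1[OF conjunct2[OF T]] by (rule summable_norm_cancel)
qed

text \<open>Each \<open>s n\<close> is the pairing of \<open>K (e n)\<close> with the normalized
  image \<open>f n\<close>. Inserting the representation and summing over \<open>n\<close> first,
  the \<open>k\<close>-th term contributes at most \<open>norm (a k) * norm (b k)\<close>.\<close>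

lemma (in schmidt_decomposition) sum_s_le_nuclear:
  assumes "nuclear_rep K a b"
  shows "(\<Sum>n<N. s n) \<le> (\<Sum>k. norm (a k) * norm (b k))"
proof -
  \<comment> \<open>Where \<open>s n = 0\<close> the inverse is zero, so \<open>f n\<close> is zero
    and the family stays orthogonal with norms at most one.\<close>
  define f where "f n = inverse (s n) *\<^sub>R blinfun_apply K (e n)" for n
  have f_orth: "cinner (f m) (f n) = 0" if "m \<noteq> n" for m n
    using that by (simp add: f_def cinner.scaleR_left cinner.scaleR_right image_orthogonal)
  have f_norm: "norm (f n) \<le> 1" for n
    using s_nonneg[of n] by (cases "s n = 0") (simp_all add: f_def norm_image)
  have e_norm: "norm (e n) \<le> 1" for n by (simp add: norm_e)
  have s_eq: "cinner (blinfun_apply K (e n)) (f n) = complex_of_real (s n)" for n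
    by (cases "s n = 0")
      (simp_all add: f_def cinner.zero_right cinner.scaleR_right cinner_self norm_image scaleR_conv_of_real power2_eq_square)
  let ?t = "\<lambda>k. \<Sum>n<N. cinner (e n) (a k) * cinner (b k) (f n)"
  have sums: "?t sums (\<Sum>n<N. complex_of_real (s n))"
    unfolding s_eq[symmetric] by (intro sums_sum nuclear_rep_cinner_sums[OF assms])
  have "norm (?t k) \<le> norm (a k) * norm (b k)" for k
  proof -
    have "norm (?t k) \<le> (\<Sum>n<N. cmod (cinner (a k) (e n)) * cmod (cinner (b k) (f n)))"
      by (rule sum_norm_le) (simp add: norm_mult cinner_commute[of "a k" "e _"])
    also have "\<dots> \<le> norm (a k) * norm (b k)"
      by (rule sum_cinner_mult_le) (simp_all add: orthogonal e_norm f_orth f_norm)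
    finally show ?thesis .
  qed
  then have "norm (suminf ?t) \<le> (\<Sum>k. norm (a k) * norm (b k))"
    using assms by (intro norm_suminf_le) (auto simp: nuclear_rep_def)
  moreover have "norm (suminf ?t) = \<bar>\<Sum>n<N. s n\<bar>"
    using sums by (simp add: sums_iff flip: of_real_sum)
  ultimately show ?thesis by simp
qed


section \<open>Finite-rank and rank-one operators\<close>

lemma op_trace_zero: "op_trace 0 = 0"
  by (simp add: op_trace_def cinner.zero_left)

text \<open>Padding with zero vectors turns a finite sum into a nuclear representation, so the
  results for series apply to it.\<close>

lemma nuclear_rep_finite:
  assumes "\<And>x. blinfun_apply L x = (\<Sum>k<n. scaleC (cinner x (a k)) (b k))"
  shows "nuclear_rep L (\<lambda>k. if k < n then a k else 0) (\<lambda>k. if k < n then b k else 0)"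
    and "(\<Sum>k. norm (if k < n then a k else 0) * norm (if k < n then b k else 0)) = (\<Sum>k<n. norm (a k) * norm (b k))"
    and "op_trace L = (\<Sum>k<n. cinner (b k) (a k))"
proof -
  let ?a = "\<lambda>k. if k < n then a k else 0" and ?b = "\<lambda>k. if k < n then b k else 0"
  have 1: "(\<lambda>k. norm (?a k) * norm (?b k)) sums (\<Sum>k<n. norm (?a k) * norm (?b k))"
    by (rule sums_finite) auto
  have 2: "(\<lambda>k. scaleC (cinner x (?a k)) (?b k)) sums (\<Sum>k<n. scaleC (cinner x (?a k)) (?b k))" for x
    by (rule sums_finite) auto
  have 3: "(\<lambda>k. cinner (?b k) (?a k)) sums (\<Sum>k<n. cinner (?b k) (?a k))"
    by (rule sums_finite) (auto simp: cinner.zero_left)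
  show rep: "nuclear_rep L ?a ?b"
    unfolding nuclear_rep_def assms using sums_summable[OF 1] 2 by simp
  show "(\<Sum>k. norm (?a k) * norm (?b k)) = (\<Sum>k<n. norm (a k) * norm (b k))"
    using sums_unique[OF 1] by simp
  show "op_trace L = (\<Sum>k<n. cinner (b k) (a k))"
    using nuclear_rep_trace(2)[OF rep] sums_unique[OF 3] by simp
qed

lemma op_trace_ket_bra: "op_trace (ket_bra b a) = cinner b a"
  using nuclear_rep_finite(3)[of "ket_bra b a" "\<lambda>_. a" "\<lambda>_. b" "Suc 0"] by (simp add: ket_bra)

lemma norm_ket_bra_le: "norm (ket_bra b a) \<le> norm a * norm b"
proof (rule norm_blinfun_bound)
  show "norm (blinfun_apply (ket_bra b a) x) \<le> norm a * norm b * norm x" for x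
    using mult_right_mono[OF cinner_norm_le[of x a], of "norm b"]
    by (simp add: ket_bra norm_scaleC mult_ac)
qed simp

lemma compose_ket_bra: "X \<in> bounded_ops \<Longrightarrow> X o\<^sub>L ket_bra b a = ket_bra (blinfun_apply X b) a"
  by (rule blinfun_eqI) (simp add: ket_bra bounded_opsD)

lemma ket_bra_compose:
  "K \<in> bounded_ops \<Longrightarrow> ket_bra b a o\<^sub>L K = ket_bra b (blinfun_apply (hilbert_adjoint K) a)"
  by (rule blinfun_eqI) (simp add: ket_bra hilbert_adjoint(2))

lemma rank_one_ket_bra:
  assumes "rank_one X"
  obtains a b where "X = ket_bra b a" "b \<noteq> 0" "norm X = norm a * norm b"
proof -
  have X: "X \<in> bounded_ops" and d: "ell2.dim (range (blinfun_apply X)) = 1"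
    using assms by (auto simp: rank_one_def)
  obtain B where B: "B \<subseteq> range (blinfun_apply X)" "ell2.independent B"
    "range (blinfun_apply X) \<subseteq> ell2.span B" "card B = 1"
    using ell2.basis_exists[of "range (blinfun_apply X)"] d by metis
  from B(4) obtain b where b: "B = {b}" by (auto simp: card_1_singleton_iff)
  have b0: "b \<noteq> 0" using B(2) b ell2.dependent_zero by auto
  \<comment> \<open>Chosen so that \<open>cinner x a\<close> is the coefficient of
    \<open>X x\<close> with respect to the spanning vector \<open>b\<close>.\<close>
  define a where "a = scaleC (inverse (complex_of_real ((norm b)\<^sup>2))) (blinfun_apply (hilbert_adjoint X) b)"
  have Xeq: "X = ket_bra b a"
  proof (rule blinfun_eqI)
    fix x
    have "blinfun_apply X x \<in> ell2.span {b}" using B(3) b by auto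
    then obtain c where c: "blinfun_apply X x = scaleC c b"
      by (auto simp: ell2.span_singleton)
    have "cinner x a = inverse (complex_of_real ((norm b)\<^sup>2)) * cinner (blinfun_apply X x) b"
      by (simp add: a_def cinner_scaleC_right hilbert_adjoint(2)[OF X])
    also have "\<dots> = c" using b0 by (simp add: c cinner_scaleC_left cinner_self)
    finally show "blinfun_apply X x = blinfun_apply (ket_bra b a) x" by (simp add: ket_bra c)
  qed
  \<comment> \<open>The vector \<open>a\<close> itself is extremal for the norm of \<open>X\<close>,
    because \<open>X a\<close> is \<open>b\<close> scaled by the squared norm of
    \<open>a\<close>.\<close>
  have "norm a * norm b * norm a \<le> norm X * norm a"
    using norm_blinfun[of X a] by (simp add: Xeq ket_bra norm_scaleC cinner_self norm_mult power2_eq_square mult_ac)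
  then have "norm a * norm b \<le> norm X"
    by (cases "norm a = 0") (auto simp: mult.commute)
  then have "norm X = norm a * norm b" using norm_ket_bra_le[of b a] by (simp add: Xeq)
  then show ?thesis using that Xeq b0 by blast
qed

section \<open>The norming function\<close>

text \<open>Halving normalizes the value at the first unit sequence to one. On \<open>c00\<close>
  the supremum is a maximum, since the range is finite.\<close>

definition pi_function :: "(nat \<Rightarrow> real) \<Rightarrow> real" where
  "pi_function \<xi> = (max_sn_function \<xi> + (SUP j. \<bar>\<xi> j\<bar>)) / 2"

lemma max_sn_function_eq_sum:
  assumes "finite A" "\<And>j. j \<notin> A \<Longrightarrow> \<xi> j = 0"
  shows "max_sn_function \<xi> = (\<Sum>j\<in>A. \<bar>\<xi> j\<bar>)"
  unfolding max_sn_function_def by (rule sum.mono_neutral_left) (use assms in auto)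

lemma finite_range_c00:
  assumes "\<xi> \<in> c00"
  shows "finite (range (\<lambda>j. \<bar>\<xi> j\<bar>))"
proof (rule finite_subset)
  show "range (\<lambda>j. \<bar>\<xi> j\<bar>) \<subseteq> insert 0 ((\<lambda>j. \<bar>\<xi> j\<bar>) ` {j. \<xi> j \<noteq> 0})" by auto
  show "finite (insert 0 ((\<lambda>j. \<bar>\<xi> j\<bar>) ` {j. \<xi> j \<noteq> 0}))" using assms by (simp add: c00_def)
qed

lemma abs_le_SUP_c00: "\<xi> \<in> c00 \<Longrightarrow> \<bar>\<xi> j\<bar> \<le> (SUP j. \<bar>\<xi> j\<bar>)"
  by (intro cSUP_upper bdd_above_finite finite_range_c00) auto

lemma SUP_abs_le_max_sn_function:
  assumes "\<xi> \<in> c00"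
  shows "(SUP j. \<bar>\<xi> j\<bar>) \<le> max_sn_function \<xi>"
proof (rule cSUP_least)
  fix j
  show "\<bar>\<xi> j\<bar> \<le> max_sn_function \<xi>"
  proof (cases "\<xi> j = 0")
    case False
    then show ?thesis
      unfolding max_sn_function_def using assms by (intro member_le_sum) (auto simp: c00_def)
  qed (simp add: max_sn_function_def sum_nonneg)
qed simp

lemma SUP_abs_nonneg: "\<xi> \<in> c00 \<Longrightarrow> 0 \<le> (SUP j. \<bar>\<xi> j\<bar>)"
  by (rule order_trans[OF abs_ge_zero abs_le_SUP_c00[of \<xi> 0]])

lemma pi_function_le: "\<xi> \<in> c00 \<Longrightarrow> pi_function \<xi> \<le> max_sn_function \<xi>"
  using SUP_abs_le_max_sn_function[of \<xi>] by (simp add: pi_function_def)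

lemma max_sn_function_le: "\<xi> \<in> c00 \<Longrightarrow> max_sn_function \<xi> \<le> 2 * pi_function \<xi>"
  using SUP_abs_nonneg[of \<xi>] by (simp add: pi_function_def)

lemma max_sn_function_nonneg: "0 \<le> max_sn_function \<xi>"
  by (simp add: max_sn_function_def sum_nonneg)

lemma sn_equivalent_pi_function: "sn_equivalent pi_function max_sn_function"
proof -
  \<comment> \<open>Division by zero yields zero, so both quotient bounds hold at the zero sequence
    too.\<close>
  have "pi_function \<xi> / max_sn_function \<xi> \<le> 1" if "\<xi> \<in> c00" for \<xi>
    using pi_function_le[OF that] max_sn_function_nonneg[of \<xi>]
    by (cases "max_sn_function \<xi> = 0") (auto simp: divide_le_eq)
  moreover have "max_sn_function \<xi> / pi_function \<xi> \<le> 2" if "\<xi> \<in> c00" for \<xi>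
    using max_sn_function_le[OF that] max_sn_function_nonneg[of \<xi>]
    by (cases "pi_function \<xi> = 0") (auto simp: divide_le_eq)
  ultimately show ?thesis
    unfolding sn_equivalent_def by (auto intro!: bdd_aboveI2)
qed

lemma sn_function_pi_function: "sn_function pi_function"
proof -
  have supp: "finite {j. \<xi> j \<noteq> 0}" if "\<xi> \<in> c00" for \<xi> using that by (simp add: c00_def)
  have zero: "\<xi> = (\<lambda>_. 0)" if "\<xi> \<in> c00" "pi_function \<xi> = 0" for \<xi>
  proof
    fix j
    have "\<bar>\<xi> j\<bar> \<le> 0"
      using that abs_le_SUP_c00[OF that(1), of j] SUP_abs_nonneg[OF that(1)] max_sn_function_nonneg[of \<xi>]
      by (simp add: pi_function_def)
    then show "\<xi> j = 0" by simp
  qed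
  have nonneg: "0 \<le> pi_function \<xi>" if "\<xi> \<in> c00" for \<xi>
    using max_sn_function_le[OF that] max_sn_function_nonneg[of \<xi>] by simp
  have at_zero: "pi_function (\<lambda>_. 0) = 0"
    by (simp add: pi_function_def max_sn_function_def)
  have scale: "pi_function (\<lambda>n. a * \<xi> n) = \<bar>a\<bar> * pi_function \<xi>" if "\<xi> \<in> c00" for \<xi> a
  proof (cases "a = 0")
    case False
    have c: "(\<lambda>n. a * \<xi> n) \<in> c00" using that False by (simp add: c00_def)
    have "(SUP j. \<bar>\<xi> j\<bar>) \<le> (SUP j. \<bar>a * \<xi> j\<bar>) / \<bar>a\<bar>"
      using abs_le_SUP_c00[OF c] False by (intro cSUP_least) (auto simp: field_simps abs_mult)
    moreover have "(SUP j. \<bar>a * \<xi> j\<bar>) \<le> \<bar>a\<bar> * (SUP j. \<bar>\<xi> j\<bar>)"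
      using abs_le_SUP_c00[OF that] by (intro cSUP_least) (auto simp: abs_mult intro: mult_left_mono)
    ultimately have "(SUP j. \<bar>a * \<xi> j\<bar>) = \<bar>a\<bar> * (SUP j. \<bar>\<xi> j\<bar>)"
      using False by (simp add: field_simps)
    moreover have "max_sn_function (\<lambda>n. a * \<xi> n) = \<bar>a\<bar> * max_sn_function \<xi>"
      using False by (simp add: max_sn_function_def sum_distrib_left abs_mult)
    ultimately show ?thesis by (simp add: pi_function_def algebra_simps)
  qed (simp add: at_zero)
  have triangle: "pi_function (\<lambda>n. \<xi> n + \<eta> n) \<le> pi_function \<xi> + pi_function \<eta>"
    if "\<xi> \<in> c00" "\<eta> \<in> c00" for \<xi> \<eta>
  proof -
    let ?A = "{j. \<xi> j \<noteq> 0} \<union> {j. \<eta> j \<noteq> 0}"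
    have A: "finite ?A" using that supp by simp
    have "max_sn_function (\<lambda>n. \<xi> n + \<eta> n) = (\<Sum>j\<in>?A. \<bar>\<xi> j + \<eta> j\<bar>)"
      by (rule max_sn_function_eq_sum[OF A]) auto
    also have "\<dots> \<le> (\<Sum>j\<in>?A. \<bar>\<xi> j\<bar> + \<bar>\<eta> j\<bar>)" by (intro sum_mono) simp
    also have "\<dots> = max_sn_function \<xi> + max_sn_function \<eta>"
      using max_sn_function_eq_sum[OF A, of \<xi>] max_sn_function_eq_sum[OF A, of \<eta>] by (simp add: sum.distrib)
    finally have "max_sn_function (\<lambda>n. \<xi> n + \<eta> n) \<le> max_sn_function \<xi> + max_sn_function \<eta>" .
    moreover have "(SUP j. \<bar>\<xi> j + \<eta> j\<bar>) \<le> (SUP j. \<bar>\<xi> j\<bar>) + (SUP j. \<bar>\<eta> j\<bar>)"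
    proof (rule cSUP_least)
      show "\<bar>\<xi> j + \<eta> j\<bar> \<le> (SUP j. \<bar>\<xi> j\<bar>) + (SUP j. \<bar>\<eta> j\<bar>)" for j
        using abs_le_SUP_c00[OF that(1), of j] abs_le_SUP_c00[OF that(2), of j] by linarith
    qed simp
    ultimately show ?thesis
      unfolding pi_function_def add_divide_distrib[symmetric]
      by (intro divide_right_mono) (simp_all only: add_mono add.assoc add.left_commute add.commute zero_le_numeral)
  qed
  have unit: "pi_function (\<lambda>n. if n = 0 then 1 else 0) = 1"
  proof -
    have "max_sn_function (\<lambda>n. if n = 0 then 1 else 0) = 1"
      by (subst max_sn_function_eq_sum[of "{0}"]) auto
    moreover have "(SUP j::nat. \<bar>if j = 0 then 1 else 0 :: real\<bar>) = 1"
      by (rule cSup_eq_maximum) auto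
    ultimately show ?thesis by (simp add: pi_function_def)
  qed
  have perm: "pi_function (\<xi> \<circ> p) = pi_function \<xi>" if "bij p" for \<xi> p
  proof -
    have "bij_betw p {j. \<xi> (p j) \<noteq> 0} {j. \<xi> j \<noteq> 0}"
      using surj_image_vimage_eq[OF bij_is_surj[OF that], of "{j. \<xi> j \<noteq> 0}"]
      by (intro bij_betw_imageI inj_on_subset[OF bij_is_inj[OF that]]) (simp_all add: vimage_def)
    then have "max_sn_function (\<xi> \<circ> p) = max_sn_function \<xi>"
      unfolding max_sn_function_def o_def by (rule sum.reindex_bij_betw)
    moreover have "range (\<lambda>j. \<bar>\<xi> (p j)\<bar>) = range (\<lambda>j. \<bar>\<xi> j\<bar>)"
      using image_image[of "\<lambda>j. \<bar>\<xi> j\<bar>" p UNIV] by (simp only: bij_is_surj[OF that])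
    ultimately show ?thesis by (simp add: pi_function_def)
  qed
  have "pi_function (\<lambda>n. \<bar>\<xi> n\<bar>) = pi_function \<xi>" for \<xi>
    by (simp add: pi_function_def max_sn_function_def)
  then show ?thesis
    unfolding sn_function_def using zero nonneg at_zero scale triangle unit perm by blast
qed

section \<open>The trace ideal\<close>

lemma (in schmidt_decomposition) ideal_norm_pi_function:
  assumes "summable s"
  shows "ideal_norm pi_function K = ((\<Sum>n. s n) + norm K) / 2"
proof -
  \<comment> \<open>Every nonempty truncation contains \<open>s 0\<close>, the operator norm, so the
    supremum is constant and only the sum has a limit to take. The index \<open>Suc n\<close>
    excludes the empty truncation.\<close>
  have "pi_function (\<lambda>j. if j < Suc n then s j else 0) = ((\<Sum>j<Suc n. s j) + norm K) / 2" for n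
  proof -
    have "max_sn_function (\<lambda>j. if j < Suc n then s j else 0) = (\<Sum>j<Suc n. s j)"
      by (subst max_sn_function_eq_sum[of "{..<Suc n}"]) (auto simp: s_nonneg)
    moreover have "(SUP j. \<bar>if j < Suc n then s j else 0\<bar>) = s 0"
      by (rule cSup_eq_maximum) (auto simp: s_nonneg intro: decseqD[OF s_decseq] image_eqI[of _ _ 0])
    ultimately show ?thesis by (simp only: pi_function_def s_0)
  qed
  moreover have "(\<lambda>n. ((\<Sum>j<Suc n. s j) + norm K) / 2) \<longlonglongrightarrow> ((\<Sum>n. s n) + norm K) / 2"
    by (intro tendsto_intros LIMSEQ_Suc[OF summable_LIMSEQ[OF assms]]) simp
  ultimately have "(\<lambda>n. pi_function (\<lambda>j. if j < Suc n then s j else 0)) \<longlonglongrightarrow> ((\<Sum>n. s n) + norm K) / 2"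
    by (simp only:)
  then show ?thesis
    unfolding ideal_norm_def singular_values_eq by (rule limI[OF LIMSEQ_imp_Suc])
qed

lemma trace_class_schmidt:
  assumes "K \<in> trace_class"
  obtains e s where "schmidt_decomposition K e s" "summable s"
proof -
  obtain e s where es: "schmidt_decomposition K e s"
    using assms schmidt_decomposition_exists[of K] unfolding trace_class_def by blast
  then interpret schmidt_decomposition K e s .
  show ?thesis using that[OF es] assms by (simp add: trace_class_def singular_values_eq)
qed

text \<open>Gives membership and a norm bound from any nuclear representation, without computing the
  singular values of \<open>L\<close>.\<close>

lemma nuclear_trace_class:
  assumes "compact_op L" "nuclear_rep L a b"
  shows "L \<in> trace_class"
    and "ideal_norm pi_function L \<le> ((\<Sum>k. norm (a k) * norm (b k)) + norm L) / 2"
proof -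
  obtain e s where "schmidt_decomposition L e s"
    using schmidt_decomposition_exists[OF assms(1)] by blast
  then interpret schmidt_decomposition L e s .
  have sm: "summable s"
    using s_nonneg sum_s_le_nuclear[OF assms(2)] by (rule summableI_nonneg_bounded)
  then show "L \<in> trace_class" using assms by (simp add: trace_class_def singular_values_eq)
  show "ideal_norm pi_function L \<le> ((\<Sum>k. norm (a k) * norm (b k)) + norm L) / 2"
    using suminf_le_const[OF sm sum_s_le_nuclear[OF assms(2)]] by (simp add: ideal_norm_pi_function[OF sm])
qed

lemma trace_class_ket_bra: "ket_bra b a \<in> trace_class" "ideal_norm pi_function (ket_bra b a) \<le> norm a * norm b"
proof -
  have *: "blinfun_apply (ket_bra b a) x = (\<Sum>k<Suc 0. scaleC (cinner x a) b)" for x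
    by (simp add: ket_bra)
  note rep = nuclear_rep_finite(1,2)[of "ket_bra b a" "\<lambda>_. a" "\<lambda>_. b" "Suc 0", OF *]
  show "ket_bra b a \<in> trace_class" by (rule nuclear_trace_class[OF compact_op_ket_bra rep(1)])
  show "ideal_norm pi_function (ket_bra b a) \<le> norm a * norm b"
    using nuclear_trace_class(2)[OF compact_op_ket_bra rep(1), unfolded rep(2)] norm_ket_bra_le[of b a]
    by simp
qed

lemma trace_class_zero: "0 \<in> trace_class" "ideal_norm pi_function 0 \<le> 0"
proof -
  have "ket_bra 0 0 = 0" by (rule blinfun_eqI) (simp add: ket_bra)
  then show "0 \<in> trace_class" "ideal_norm pi_function 0 \<le> 0"
    using trace_class_ket_bra[of 0 0] by simp_all
qed

text \<open>Apply \<open>B\<close> to the expansion of \<open>K\<close> at \<open>A x\<close> and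
  move \<open>A\<close> onto the vectors \<open>e k\<close> as its adjoint.\<close>

lemma (in schmidt_decomposition) nuclear_rep_compose:
  assumes "summable s" "A \<in> bounded_ops" "B \<in> bounded_ops"
  shows "nuclear_rep (B o\<^sub>L K o\<^sub>L A) (\<lambda>k. blinfun_apply (hilbert_adjoint A) (e k)) (\<lambda>k. blinfun_apply B (blinfun_apply K (e k)))"
    and "(\<Sum>k. norm (blinfun_apply (hilbert_adjoint A) (e k)) * norm (blinfun_apply B (blinfun_apply K (e k))))
      \<le> norm A * norm B * (\<Sum>k. s k)"
proof -
  let ?t = "\<lambda>k. norm (blinfun_apply (hilbert_adjoint A) (e k)) * norm (blinfun_apply B (blinfun_apply K (e k)))"
  have le: "?t k \<le> norm A * norm B * s k" for k
  proof -
    have "norm (blinfun_apply (hilbert_adjoint A) (e k)) \<le> norm A"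
      using norm_hilbert_adjoint_apply[OF assms(2), of "e k"] by (cases "s k = 0") (simp_all add: norm_e)
    moreover have "norm (blinfun_apply B (blinfun_apply K (e k))) \<le> norm B * s k"
      using norm_blinfun[of B "blinfun_apply K (e k)"] by (simp add: norm_image)
    ultimately have "?t k \<le> norm A * (norm B * s k)" by (intro mult_mono) auto
    then show ?thesis by (simp add: mult.assoc)
  qed
  have sm: "summable ?t"
    by (rule summable_comparison_test'[OF summable_mult[OF assms(1), of "norm A * norm B"]]) (simp add: le)
  have "(\<lambda>k. scaleC (cinner x (blinfun_apply (hilbert_adjoint A) (e k))) (blinfun_apply B (blinfun_apply K (e k))))
      sums blinfun_apply (B o\<^sub>L K o\<^sub>L A) x" for x
    using bounded_linear.sums[OF blinfun.bounded_linear_right[of B] expansion[of "blinfun_apply A x"]]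
    by (simp add: bounded_opsD[OF assms(3)] hilbert_adjoint(2)[OF assms(2)])
  then show "nuclear_rep (B o\<^sub>L K o\<^sub>L A) (\<lambda>k. blinfun_apply (hilbert_adjoint A) (e k)) (\<lambda>k. blinfun_apply B (blinfun_apply K (e k)))"
    using sm by (simp add: nuclear_rep_def)
  show "suminf ?t \<le> norm A * norm B * (\<Sum>k. s k)"
    using suminf_le[OF le sm summable_mult[OF assms(1)]] by (simp add: suminf_mult[OF assms(1)])
qed

section \<open>Traces of products with a trace class operator\<close>

lemma (in schmidt_decomposition) nuclear_rep_compose_left:
  assumes "summable s" "X \<in> bounded_ops"
  shows "nuclear_rep (X o\<^sub>L K) e (\<lambda>k. blinfun_apply X (blinfun_apply K (e k)))"
proof -
  have "hilbert_adjoint id_blinfun = id_blinfun"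
    by (intro blinfun_eqI cinner_eqI) (simp add: hilbert_adjoint(2)[OF bounded_ops_id, symmetric])
  moreover have "X o\<^sub>L K o\<^sub>L id_blinfun = X o\<^sub>L K" by (rule blinfun_eqI) simp
  ultimately show ?thesis using nuclear_rep_compose(1)[OF assms(1) bounded_ops_id assms(2)] by simp
qed

text \<open>Convergence of the diagonal series is what allows \<open>op_trace\<close>, defined by
  \<open>suminf\<close>, to be added and scaled termwise.\<close>

lemma op_trace_compose_sums:
  assumes "K \<in> trace_class" "X \<in> bounded_ops"
  shows "(\<lambda>n. cinner (blinfun_apply X (blinfun_apply K (unit_vec n))) (unit_vec n)) sums op_trace (X o\<^sub>L K)"
proof -
  obtain e s where "schmidt_decomposition K e s" "summable s"
    using trace_class_schmidt[OF assms(1)] .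
  then interpret schmidt_decomposition K e s by simp
  show ?thesis
    using nuclear_rep_trace(1,2)[OF nuclear_rep_compose_left[OF \<open>summable s\<close> assms(2)]] by simp
qed

lemma op_trace_compose_add:
  assumes "K \<in> trace_class" "X \<in> bounded_ops" "Y \<in> bounded_ops"
  shows "op_trace ((X + Y) o\<^sub>L K) = op_trace (X o\<^sub>L K) + op_trace (Y o\<^sub>L K)"
  using sums_add[OF op_trace_compose_sums[OF assms(1,2)] op_trace_compose_sums[OF assms(1,3)]]
  unfolding op_trace_def[of "(X + Y) o\<^sub>L K"] by (simp add: sums_iff blinfun.add_left cinner_add_left)

lemma op_trace_compose_scale:
  assumes "K \<in> trace_class" "X \<in> bounded_ops"
  shows "op_trace (scaleC_op c X o\<^sub>L K) = c * op_trace (X o\<^sub>L K)"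
  using sums_mult[OF op_trace_compose_sums[OF assms], of c]
  unfolding op_trace_def[of "scaleC_op c X o\<^sub>L K"] by (simp add: sums_iff scaleC_op_apply cinner_scaleC_left)

lemma scaleC_op_bounded_ops: "X \<in> bounded_ops \<Longrightarrow> scaleC_op c X \<in> bounded_ops"
  by (simp add: bounded_ops_def scaleC_op_apply mult.commute)

text \<open>The nuclear representation of the product gives the first two claims. For the third,
  both traces are the same series over the \<open>e k\<close>, with \<open>A\<close> on one side of
  the inner product or its adjoint on the other.\<close>

lemma trace_class_sandwich:
  assumes "K \<in> trace_class" "A \<in> bounded_ops" "B \<in> bounded_ops"
  shows "B o\<^sub>L K o\<^sub>L A \<in> trace_class"
    and "ideal_norm pi_function (B o\<^sub>L K o\<^sub>L A) \<le> norm A * norm B * ideal_norm pi_function K"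
    and "X \<in> bounded_ops \<Longrightarrow> op_trace (X o\<^sub>L (B o\<^sub>L K o\<^sub>L A)) = op_trace ((A o\<^sub>L X o\<^sub>L B) o\<^sub>L K)"
proof -
  obtain e s where "schmidt_decomposition K e s" and sm: "summable s"
    using trace_class_schmidt[OF assms(1)] .
  then interpret schmidt_decomposition K e s by simp
  have compact: "compact_op (B o\<^sub>L K o\<^sub>L A)"
    using assms by (intro compact_op_compose) (auto simp: trace_class_def)
  note rep = nuclear_rep_compose[OF sm assms(2,3)]
  show "B o\<^sub>L K o\<^sub>L A \<in> trace_class" by (rule nuclear_trace_class[OF compact rep(1)])
  have "norm (B o\<^sub>L K o\<^sub>L A) \<le> norm A * norm B * norm K"
    using norm_blinfun_compose[of "B o\<^sub>L K" A] mult_right_mono[OF norm_blinfun_compose[of B K], of "norm A"]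
    by (simp add: mult_ac)
  then show "ideal_norm pi_function (B o\<^sub>L K o\<^sub>L A) \<le> norm A * norm B * ideal_norm pi_function K"
    using nuclear_trace_class(2)[OF compact rep(1)] rep(2)
    by (simp add: ideal_norm_pi_function[OF sm] algebra_simps)
  assume X: "X \<in> bounded_ops"
  have "X o\<^sub>L (B o\<^sub>L K o\<^sub>L A) = (X o\<^sub>L B) o\<^sub>L K o\<^sub>L A" by (rule blinfun_eqI) simp
  then have "op_trace (X o\<^sub>L (B o\<^sub>L K o\<^sub>L A))
      = (\<Sum>k. cinner (blinfun_apply X (blinfun_apply B (blinfun_apply K (e k)))) (blinfun_apply (hilbert_adjoint A) (e k)))"
    using nuclear_rep_trace(2)[OF nuclear_rep_compose(1)[OF sm assms(2) bounded_ops_compose[OF X assms(3)]]] by simp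
  also have "\<dots> = op_trace ((A o\<^sub>L X o\<^sub>L B) o\<^sub>L K)"
    using nuclear_rep_trace(2)[OF nuclear_rep_compose_left[OF sm bounded_ops_compose[OF bounded_ops_compose[OF assms(2) X] assms(3)]]]
    by (simp add: hilbert_adjoint(2)[OF assms(2)])
  finally show "op_trace (X o\<^sub>L (B o\<^sub>L K o\<^sub>L A)) = op_trace ((A o\<^sub>L X o\<^sub>L B) o\<^sub>L K)" .
qed

text \<open>The factor \<open>2 * ideal_norm pi_function K - norm K\<close> is the trace norm of
  \<open>K\<close>. Keeping the subtracted \<open>norm K\<close> makes the bound strict for the
  identity later on.\<close>

lemma trace_class_bounds:
  assumes "K \<in> trace_class"
  shows "norm K \<le> ideal_norm pi_function K"
    and "X \<in> bounded_ops \<Longrightarrow> cmod (op_trace (X o\<^sub>L K)) \<le> norm X * (2 * ideal_norm pi_function K - norm K)"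
proof -
  obtain e s where "schmidt_decomposition K e s" and sm: "summable s"
    using trace_class_schmidt[OF assms(1)] .
  then interpret schmidt_decomposition K e s by simp
  have "sum s {0} \<le> (\<Sum>k. s k)" by (rule sum_le_suminf[OF sm]) (auto simp: s_nonneg)
  then show "norm K \<le> ideal_norm pi_function K"
    by (simp add: ideal_norm_pi_function[OF sm] s_0)
  assume X: "X \<in> bounded_ops"
  note rep = nuclear_rep_compose_left[OF sm X]
  have le: "cmod (cinner (blinfun_apply X (blinfun_apply K (e k))) (e k)) \<le> norm X * s k" for k
  proof -
    have "cmod (cinner (blinfun_apply X (blinfun_apply K (e k))) (e k))
        \<le> norm (blinfun_apply X (blinfun_apply K (e k))) * norm (e k)" by (rule cinner_norm_le)
    also have "\<dots> \<le> norm (blinfun_apply X (blinfun_apply K (e k))) * 1"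
      by (intro mult_left_mono) (auto simp: norm_e)
    also have "\<dots> \<le> norm X * s k"
      using norm_blinfun[of X "blinfun_apply K (e k)"] by (simp add: norm_image)
    finally show ?thesis .
  qed
  have "cmod (op_trace (X o\<^sub>L K)) \<le> (\<Sum>k. norm X * s k)"
    unfolding nuclear_rep_trace(2)[OF rep]
    by (rule norm_suminf_le[OF le summable_mult[OF sm]])
  then show "cmod (op_trace (X o\<^sub>L K)) \<le> norm X * (2 * ideal_norm pi_function K - norm K)"
    by (simp add: ideal_norm_pi_function[OF sm] suminf_mult[OF sm] add_divide_distrib)
qed


section \<open>The dual norm\<close>

lemma dual_norm_bdd_above:
  assumes "X \<in> bounded_ops"
  shows "bdd_above {cmod (op_trace (X o\<^sub>L K)) | K. K \<in> trace_class \<and> ideal_norm pi_function K \<le> 1}"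
proof (rule bdd_aboveI)
  fix r assume "r \<in> {cmod (op_trace (X o\<^sub>L K)) | K. K \<in> trace_class \<and> ideal_norm pi_function K \<le> 1}"
  then obtain K where K: "K \<in> trace_class" "ideal_norm pi_function K \<le> 1" "r = cmod (op_trace (X o\<^sub>L K))"
    by blast
  have "r \<le> norm X * (2 * ideal_norm pi_function K - norm K)"
    using trace_class_bounds(2)[OF K(1) assms] K(3) by simp
  also have "\<dots> \<le> norm X * 2"
    using K(2) norm_ge_zero[of K] by (intro mult_left_mono) (linarith, simp)
  finally show "r \<le> norm X * 2" .
qed

lemma dual_norm_least:
  assumes "\<And>K. K \<in> trace_class \<Longrightarrow> ideal_norm pi_function K \<le> 1 \<Longrightarrow> cmod (op_trace (X o\<^sub>L K)) \<le> c"
  shows "dual_norm pi_function X \<le> c"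
  unfolding dual_norm_def
proof (rule cSup_least)
  have "ideal_norm pi_function 0 \<le> 1" using trace_class_zero(2) by simp
  then show "{cmod (op_trace (X o\<^sub>L K)) | K. K \<in> trace_class \<and> ideal_norm pi_function K \<le> 1} \<noteq> {}"
    using trace_class_zero(1) by blast
qed (use assms in blast)

lemma dual_norm_upper_unit:
  assumes "X \<in> bounded_ops" "K \<in> trace_class" "ideal_norm pi_function K \<le> 1"
  shows "cmod (op_trace (X o\<^sub>L K)) \<le> dual_norm pi_function X"
  unfolding dual_norm_def by (rule cSup_upper[OF _ dual_norm_bdd_above[OF assms(1)]]) (use assms in blast)

text \<open>Homogeneous form of the unit ball bound. Rescaling is written as composition with a
  multiple of the identity, so that the sandwich lemma supplies both the norm estimate and the
  trace.\<close>

lemma dual_norm_upper: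
  assumes X: "X \<in> bounded_ops" and K: "K \<in> trace_class"
  shows "cmod (op_trace (X o\<^sub>L K)) \<le> dual_norm pi_function X * ideal_norm pi_function K"
proof (cases "ideal_norm pi_function K = 0")
  case True
  then have "K = 0" using trace_class_bounds(1)[OF K] by simp
  then have "X o\<^sub>L K = 0" by (simp add: blinfun_eqI)
  then show ?thesis using True by (simp add: op_trace_zero)
next
  case False
  define p where "p = ideal_norm pi_function K"
  have p: "p > 0" using False trace_class_bounds(1)[OF K] norm_ge_zero[of K] unfolding p_def by linarith
  define B where "B = scaleC_op (complex_of_real (inverse p)) id_blinfun"
  have B: "B \<in> bounded_ops" unfolding B_def by (rule scaleC_op_bounded_ops[OF bounded_ops_id])
  have nB: "norm B \<le> inverse p"
    by (rule norm_blinfun_bound) (use p in \<open>simp_all add: B_def scaleC_op_apply norm_scaleC norm_inverse\<close>)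
  let ?L = "B o\<^sub>L K o\<^sub>L id_blinfun"
  note L = trace_class_sandwich[OF K bounded_ops_id B]
  have "ideal_norm pi_function ?L \<le> norm (id_blinfun :: ell2 \<Rightarrow>\<^sub>L ell2) * norm B * p"
    using L(2) by (simp add: p_def)
  also have "\<dots> \<le> 1 * inverse p * p"
    using p nB by (intro mult_mono norm_blinfun_id_le) auto
  finally have "ideal_norm pi_function ?L \<le> 1" using p by simp
  then have "cmod (op_trace (X o\<^sub>L ?L)) \<le> dual_norm pi_function X"
    by (rule dual_norm_upper_unit[OF X L(1)])
  moreover have "(id_blinfun o\<^sub>L X o\<^sub>L B) = scaleC_op (complex_of_real (inverse p)) X"
    by (rule blinfun_eqI) (simp add: B_def scaleC_op_apply bounded_opsD[OF X])
  ultimately have "inverse p * cmod (op_trace (X o\<^sub>L K)) \<le> dual_norm pi_function X"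
    using p by (simp add: L(3)[OF X] op_trace_compose_scale[OF K X] norm_mult norm_inverse)
  then show ?thesis using p by (simp add: p_def[symmetric] field_simps)
qed

lemma dual_norm_nonneg: "X \<in> bounded_ops \<Longrightarrow> 0 \<le> dual_norm pi_function X"
  by (rule order_trans[OF norm_ge_zero dual_norm_upper_unit[of X 0]]) (use trace_class_zero in simp_all)

text \<open>Testing against a rank-one operator turns the trace into a matrix coefficient. This
  yields definiteness and the lower bound for rank-one operators.\<close>

lemma inner_le_dual_norm:
  assumes "X \<in> bounded_ops"
  shows "cmod (cinner (blinfun_apply X a) b) \<le> dual_norm pi_function X * (norm a * norm b)"
proof -
  have "cmod (cinner (blinfun_apply X a) b) = cmod (op_trace (X o\<^sub>L ket_bra a b))"
    by (simp add: compose_ket_bra[OF assms] op_trace_ket_bra)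
  also have "\<dots> \<le> dual_norm pi_function X * ideal_norm pi_function (ket_bra a b)"
    by (rule dual_norm_upper[OF assms trace_class_ket_bra(1)])
  also have "\<dots> \<le> dual_norm pi_function X * (norm a * norm b)"
    using trace_class_ket_bra(2)[of a b] dual_norm_nonneg[OF assms]
    by (intro mult_left_mono) (simp_all add: mult.commute)
  finally show ?thesis .
qed

lemma dual_norm_scale_le:
  assumes "X \<in> bounded_ops"
  shows "dual_norm pi_function (scaleC_op c X) \<le> cmod c * dual_norm pi_function X"
proof (rule dual_norm_least)
  fix K assume K: "K \<in> trace_class" "ideal_norm pi_function K \<le> 1"
  show "cmod (op_trace (scaleC_op c X o\<^sub>L K)) \<le> cmod c * dual_norm pi_function X"
    unfolding op_trace_compose_scale[OF K(1) assms] norm_mult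
    by (intro mult_left_mono dual_norm_upper_unit assms K) simp
qed

lemma dual_norm_scale:
  assumes "X \<in> bounded_ops"
  shows "dual_norm pi_function (scaleC_op c X) = cmod c * dual_norm pi_function X"
proof (cases "c = 0")
  case True
  then show ?thesis
    using dual_norm_scale_le[OF assms, of c] dual_norm_nonneg[OF scaleC_op_bounded_ops[OF assms], of c] by simp
next
  case False
  \<comment> \<open>The reverse inequality is the one already proved, applied to the inverse
    scalar.\<close>
  have "scaleC_op (inverse c) (scaleC_op c X) = X"
    by (rule blinfun_eqI) (simp add: scaleC_op_apply False)
  then have "dual_norm pi_function X \<le> inverse (cmod c) * dual_norm pi_function (scaleC_op c X)"
    using dual_norm_scale_le[OF scaleC_op_bounded_ops[OF assms], of "inverse c" c] by (simp add: norm_inverse)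
  then have "cmod c * dual_norm pi_function X \<le> dual_norm pi_function (scaleC_op c X)"
    using False by (simp add: field_simps)
  with dual_norm_scale_le[OF assms, of c] show ?thesis by simp
qed

text \<open>Above, the trace is a matrix coefficient of \<open>K\<close>, controlled by
  \<open>norm K\<close>, which the ideal norm dominates. Below, the test operator
  \<open>ket_bra a b\<close> attains the value.\<close>

lemma dual_norm_rank_one:
  assumes "rank_one X"
  shows "dual_norm pi_function X = norm X"
proof -
  obtain a b where X: "X = ket_bra b a" and b: "b \<noteq> 0" and nX: "norm X = norm a * norm b"
    using rank_one_ket_bra[OF assms] .
  have "dual_norm pi_function X \<le> norm X"
  proof (rule dual_norm_least)
    fix K assume K: "K \<in> trace_class" "ideal_norm pi_function K \<le> 1"
    have Kb: "K \<in> bounded_ops" using K(1) by (simp add: trace_class_def compact_op_def)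
    have "cmod (op_trace (X o\<^sub>L K)) = cmod (cinner (blinfun_apply K b) a)"
      by (simp add: X ket_bra_compose[OF Kb] op_trace_ket_bra hilbert_adjoint(2)[OF Kb])
    also have "\<dots> \<le> norm (blinfun_apply K b) * norm a" by (rule cinner_norm_le)
    also have "\<dots> \<le> norm K * norm b * norm a" by (intro mult_right_mono norm_blinfun) simp
    also have "\<dots> \<le> 1 * norm b * norm a"
      using trace_class_bounds(1)[OF K(1)] K(2) by (intro mult_right_mono) auto
    finally show "cmod (op_trace (X o\<^sub>L K)) \<le> norm X" by (simp add: nX mult.commute)
  qed
  moreover have "norm X \<le> dual_norm pi_function X"
  proof (cases "a = 0")
    case True
    then show ?thesis unfolding nX using dual_norm_nonneg[OF ket_bra(1)[of b a]] by (simp add: X)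
  next
    case False
    then have pos: "norm a * norm b > 0" using b by simp
    have "(norm a * norm b) * (norm a * norm b) \<le> dual_norm pi_function X * (norm a * norm b)"
      using inner_le_dual_norm[OF ket_bra(1), of b a a b]
      by (simp add: X ket_bra cinner_scaleC_left cinner_self norm_mult power2_eq_square mult_ac)
    then show ?thesis using pos by (simp only: nX mult_le_cancel_right_pos)
  qed
  ultimately show ?thesis by simp
qed

lemma symmetric_norm_dual_norm: "symmetric_norm (dual_norm pi_function)"
proof -
  have definite: "X = 0" if X: "X \<in> bounded_ops" and 0: "dual_norm pi_function X = 0" for X
  proof (rule blinfun_eqI)
    fix x
    have "cmod (cinner (blinfun_apply X x) (blinfun_apply X x)) \<le> 0"
      using inner_le_dual_norm[OF X, of x "blinfun_apply X x"] 0 by simp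
    then show "blinfun_apply X x = blinfun_apply 0 x" by (simp add: cinner_self)
  qed
  have zero: "dual_norm pi_function 0 = 0"
  proof (rule antisym)
    show "dual_norm pi_function 0 \<le> 0"
    proof (rule dual_norm_least)
      fix K :: "ell2 \<Rightarrow>\<^sub>L ell2"
      have "0 o\<^sub>L K = 0" by (rule blinfun_eqI) simp
      then show "cmod (op_trace (0 o\<^sub>L K)) \<le> 0" by (simp add: op_trace_zero)
    qed
    show "0 \<le> dual_norm pi_function 0" by (rule dual_norm_nonneg) (simp add: bounded_ops_def)
  qed
  have triangle: "dual_norm pi_function (X + Y) \<le> dual_norm pi_function X + dual_norm pi_function Y"
    if X: "X \<in> bounded_ops" and Y: "Y \<in> bounded_ops" for X Y
  proof (rule dual_norm_least)
    fix K assume K: "K \<in> trace_class" "ideal_norm pi_function K \<le> 1"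
    show "cmod (op_trace ((X + Y) o\<^sub>L K)) \<le> dual_norm pi_function X + dual_norm pi_function Y"
      unfolding op_trace_compose_add[OF K(1) X Y]
      by (rule order_trans[OF norm_triangle_ineq]) (intro add_mono dual_norm_upper_unit X Y K)
  qed
  \<comment> \<open>By cyclicity, pairing \<open>A o\<^sub>L X o\<^sub>L B\<close> with
    \<open>K\<close> is pairing \<open>X\<close> with \<open>B o\<^sub>L K o\<^sub>L A\<close>,
    whose ideal norm is controlled.\<close>
  have ideal: "dual_norm pi_function (A o\<^sub>L X o\<^sub>L B) \<le> norm A * dual_norm pi_function X * norm B"
    if A: "A \<in> bounded_ops" and X: "X \<in> bounded_ops" and B: "B \<in> bounded_ops" for A X B
  proof (rule dual_norm_least)
    fix K assume K: "K \<in> trace_class" "ideal_norm pi_function K \<le> 1"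
    note L = trace_class_sandwich[OF K(1) A B]
    have "cmod (op_trace ((A o\<^sub>L X o\<^sub>L B) o\<^sub>L K))
        \<le> dual_norm pi_function X * ideal_norm pi_function (B o\<^sub>L K o\<^sub>L A)"
      using dual_norm_upper[OF X L(1)] by (simp only: L(3)[OF X])
    also have "\<dots> \<le> dual_norm pi_function X * (norm A * norm B * 1)"
      using K(2) by (intro mult_left_mono[OF order_trans[OF L(2) mult_left_mono]] dual_norm_nonneg X) auto
    finally show "cmod (op_trace ((A o\<^sub>L X o\<^sub>L B) o\<^sub>L K)) \<le> norm A * dual_norm pi_function X * norm B"
      by (simp add: mult_ac)
  qed
  show ?thesis
    unfolding symmetric_norm_def
    using definite zero triangle ideal dual_norm_nonneg dual_norm_scale dual_norm_rank_one by blast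
qed

section \<open>The identity operator\<close>

definition coordinate_projection :: "nat \<Rightarrow> (ell2 \<Rightarrow>\<^sub>L ell2)" where
  "coordinate_projection n = (\<Sum>k<n. ket_bra (unit_vec k) (unit_vec k))"

lemma coordinate_projection_apply:
  "blinfun_apply (coordinate_projection n) x = (\<Sum>k<n. scaleC (cinner x (unit_vec k)) (unit_vec k))"
  by (simp add: coordinate_projection_def blinfun.sum_left ket_bra)

lemma norm_coordinate_projection_le: "norm (coordinate_projection n) \<le> 1"
proof (rule norm_blinfun_bound)
  fix x
  let ?y = "blinfun_apply (coordinate_projection n) x"
  have c: "coord ?y j = (if j < n then coord x j else 0)" for j
    by (simp add: coordinate_projection_apply cinner_unit_vec coord_sum scaleC.rep_eq unit_vec.rep_eq
        if_distrib cong: if_cong)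
  have "(norm ?y)\<^sup>2 \<le> (norm x)\<^sup>2"
    by (rule sums_le[OF _ norm_sums_coord norm_sums_coord]) (simp add: c)
  then have "norm ?y \<le> norm x" by (rule power2_le_imp_le) simp
  then show "norm ?y \<le> 1 * norm x" by simp
qed simp

lemma dual_norm_id_ge: "2 \<le> dual_norm pi_function id_blinfun"
proof -
  let ?N = "dual_norm pi_function id_blinfun"
  \<comment> \<open>The projection has trace \<open>n\<close>, and its ideal norm is at most half of
    the sum of \<open>n\<close> and its operator norm.\<close>
  have *: "real n \<le> ?N * ((real n + 1) / 2)" for n
  proof -
    let ?P = "coordinate_projection n"
    note rep = nuclear_rep_finite[of ?P unit_vec unit_vec n, OF coordinate_projection_apply]
    have compact: "compact_op ?P"
      unfolding coordinate_projection_def by (intro compact_op_sum compact_op_ket_bra)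
    note tc = nuclear_trace_class[OF compact rep(1), unfolded rep(2)]
    have "id_blinfun o\<^sub>L ?P = ?P" by (rule blinfun_eqI) simp
    then have "real n = cmod (op_trace (id_blinfun o\<^sub>L ?P))"
      by (simp add: rep(3) cinner_self norm_unit_vec)
    also have "\<dots> \<le> ?N * ideal_norm pi_function ?P"
      by (rule dual_norm_upper[OF bounded_ops_id tc(1)])
    also have "\<dots> \<le> ?N * ((real n + 1) / 2)"
      using tc(2) norm_coordinate_projection_le[of n]
      by (intro mult_left_mono dual_norm_nonneg bounded_ops_id) (simp add: norm_unit_vec)
    finally show ?thesis .
  qed
  show ?thesis
  proof (rule ccontr)
    \<comment> \<open>The inequality above rearranges to \<open>real n * (2 - ?N) \<le> ?N\<close>,
      which fails for large \<open>n\<close> if \<open>?N < 2\<close>.\<close>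
    assume "\<not> 2 \<le> ?N"
    then obtain n :: nat where "?N < real n * (2 - ?N)"
      using reals_Archimedean3[of "2 - ?N"] by auto
    then show False using *[of n] by (simp add: field_simps)
  qed
qed

text \<open>An attaining \<open>K\<close> would satisfy \<open>2 \<le> 2 - norm K\<close>, hence
  vanish, contradicting its ideal norm one.\<close>

lemma id_not_norming: "id_blinfun \<notin> norming_ops pi_function"
proof
  assume "id_blinfun \<in> norming_ops pi_function"
  then obtain K where K: "K \<in> trace_class" "ideal_norm pi_function K = 1"
    and eq: "cmod (op_trace (id_blinfun o\<^sub>L K)) = dual_norm pi_function id_blinfun"
    unfolding norming_ops_def by blast
  have K2: "norm K \<le> 1" using trace_class_bounds(1)[OF K(1)] K(2) by simp
  have "2 \<le> norm (id_blinfun :: ell2 \<Rightarrow>\<^sub>L ell2) * (2 - norm K)"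
    using trace_class_bounds(2)[OF K(1) bounded_ops_id] dual_norm_id_ge eq K(2) by simp
  also have "\<dots> \<le> 1 * (2 - norm K)"
    using K2 by (intro mult_right_mono norm_blinfun_id_le) auto
  finally have "norm K = 0" by simp
  then have "K = 0" by simp
  then show False using K(2) trace_class_zero(2) by simp
qed

theorem proposition1p3:
  shows "\<exists>\<Phi> :: (nat \<Rightarrow> real) \<Rightarrow> real.
    sn_function \<Phi> \<and> sn_equivalent \<Phi> max_sn_function \<and>
    symmetric_norm (dual_norm \<Phi>) \<and>
    (id_blinfun :: ell2 \<Rightarrow>\<^sub>L ell2) \<notin> norming_ops \<Phi>"
  using sn_function_pi_function sn_equivalent_pi_function symmetric_norm_dual_norm id_not_norming
  by blast

end
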